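(* Let $D_\varphi(v):=\int\varphi(v,y)\,\lambda(dy)$, $D^*_\varphi:=\operatorname{ess\,sup}_{v\in\mathbb{X}}D_\varphi(v)$ and $t_T:=\sup\{t\ge0:\operatorname{ess\,sup}_{v\in\mathbb{X}}\mathbb{E}_t|V^v|<\infty\}$. Then $t_T\ge(D^*_\varphi)^{-1}$ (with $1/0=\infty$, $1/\infty=0$). Moreover, $t_T>0$ if and only if $D^*_\varphi<\infty$.
   Context: $(\mathbb{X},d)$ is a complete separable metric space with its Borel $\sigma$-field, and $\lambda$ is a locally finite (finite on bounded sets), diffuse measure on $\mathbb{X}$. The connection function $\varphi:\mathbb{X}^2\to[0,1]$ is measurable and symmetric with $D_\varphi(x)<\infty$ for $\lambda$-a.e. $x$. For a simple point process $\chi$, the random connection model (RCM) based on $\chi$ is the random graph whose vertices are the points of $\chi$ and in which each pair of distinct points $x,y$ is joined by an edge with probability $\varphi(x,y)$, independently for different pairs. $\mathbb{E}_t$ is expectation when $\eta$ is a Poisson process with intensity measure $t\lambda$. For $v\in\mathbb{X}$, $V^v$ is the vertex set of the connected component of $v$ in the RCM based on $\eta+\delta_v$, and $|V^v|$ is its cardinality. Essential suprema are with respect to $\lambda$. *)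

theory Defs
  imports "HOL-Probability.Probability"
begin

text \<open>
  A point process is given by a measurable enumeration: the random measure
  \<open>\<chi> = (\<Sum>n<N. \<delta>(X n))\<close> with a random number \<open>N\<close> of points, \<open>N\<close> possibly infinite. The values
  \<open>X n \<omega>\<close> with \<open>n \<ge> N \<omega>\<close> are irrelevant.
\<close>

definition point_count :: "('w \<Rightarrow> enat) \<Rightarrow> (nat \<Rightarrow> 'w \<Rightarrow> 'a) \<Rightarrow> 'a set \<Rightarrow> 'w \<Rightarrow> ennreal" where
  "point_count N X B \<omega> = emeasure (count_space UNIV) {n. enat n < N \<omega> \<and> X n \<omega> \<in> B}"

locale simple_point_process = prob_space M
  for M :: "'w measure" and N :: "'w \<Rightarrow> enat" and X :: "nat \<Rightarrow> 'w \<Rightarrow> 'a::polish_space" +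
  assumes number_measurable: "N \<in> M \<rightarrow>\<^sub>M count_space UNIV"
    and points_measurable: "\<And>n. X n \<in> M \<rightarrow>\<^sub>M borel"
    and locally_finite: "AE \<omega> in M. \<forall>B. bounded B \<longrightarrow> finite {n. enat n < N \<omega> \<and> X n \<omega> \<in> B}"
    and simple: "AE \<omega> in M. inj_on (\<lambda>n. X n \<omega>) {n. enat n < N \<omega>}"

locale poisson_process = simple_point_process M N X
  for M :: "'w measure" and \<mu> :: "'a::polish_space measure"
    and N :: "'w \<Rightarrow> enat" and X :: "nat \<Rightarrow> 'w \<Rightarrow> 'a" +
  assumes count_finite: "\<And>B k. \<lbrakk>B \<in> sets borel; emeasure \<mu> B < \<infinity>\<rbrakk> \<Longrightarrow>
      measure M {\<omega> \<in> space M. point_count N X B \<omega> = of_nat k}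
        = measure \<mu> B ^ k / fact k * exp (- measure \<mu> B)"
    and count_infinite: "\<And>B. \<lbrakk>B \<in> sets borel; emeasure \<mu> B = \<infinity>\<rbrakk> \<Longrightarrow>
      AE \<omega> in M. point_count N X B \<omega> = \<infinity>"
    and count_indep: "\<And>(I :: nat set) B. \<lbrakk>finite I; disjoint_family_on B I; \<And>i. i \<in> I \<Longrightarrow> B i \<in> sets borel\<rbrakk> \<Longrightarrow>
      indep_vars (\<lambda>_. borel) (\<lambda>i. point_count N X (B i)) I"

text \<open>
  Edge marks: \<open>Z (m, n)\<close>, used for \<open>m < n\<close> only, decides about the edge between the points with
  numbers \<open>m\<close> and \<open>n\<close>.
\<close>

definition mark_pairs :: "(nat \<times> nat) set" where
  "mark_pairs = {(m, n). m < n}"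

locale poisson_rcm = poisson_process M \<mu> N X
  for M :: "'w measure" and \<mu> :: "'a::polish_space measure"
    and N :: "'w \<Rightarrow> enat" and X :: "nat \<Rightarrow> 'w \<Rightarrow> 'a" and Z :: "nat \<times> nat \<Rightarrow> 'w \<Rightarrow> real" +
  assumes marks_uniform: "\<And>e. e \<in> mark_pairs \<Longrightarrow> distr M borel (Z e) = uniform_measure lborel {0..1}"
    and marks_indep: "indep_vars (\<lambda>_. borel) Z mark_pairs"
    and marks_indep_points: "indep_set
      (sets (vimage_algebra (space M) (\<lambda>\<omega>. (N \<omega>, \<lambda>n. X n \<omega>))
        (count_space UNIV \<Otimes>\<^sub>M PiM UNIV (\<lambda>_. borel))))
      (sets (vimage_algebra (space M) (\<lambda>\<omega>. \<lambda>e\<in>mark_pairs. Z e \<omega>) (PiM mark_pairs (\<lambda>_. borel))))"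

text \<open>
  The random connection model on the points \<open>Y n\<close>, \<open>n < K\<close>: as the marks are independent and
  uniform on \<open>[0,1]\<close>, given the points each pair \<open>{Y m, Y n}\<close> is an edge with
  probability \<open>\<phi> (Y m) (Y n)\<close>, independently for different pairs.
\<close>

definition rcm_edges ::
    "('a \<Rightarrow> 'a \<Rightarrow> real) \<Rightarrow> enat \<Rightarrow> (nat \<Rightarrow> 'a) \<Rightarrow> (nat \<times> nat \<Rightarrow> real) \<Rightarrow> ('a \<times> 'a) set" where
  "rcm_edges \<phi> K Y z = {(Y m, Y n) | m n.
     m \<noteq> n \<and> enat m < K \<and> enat n < K \<and> z (min m n, max m n) \<le> \<phi> (Y m) (Y n)}"

definition component :: "('a \<times> 'a) set \<Rightarrow> 'a \<Rightarrow> 'a set" where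
  "component E v = {y. (v, y) \<in> E\<^sup>*}"

text \<open>
  The model based on \<open>\<eta> + \<delta>\<^sub>v\<close> is enumerated by \<open>v, X 0, X 1, \<dots>\<close>. The measure \<open>count_space UNIV\<close>
  gives the cardinality, which is \<open>\<infinity>\<close> for infinite sets.
\<close>

definition vertex_cluster ::
    "('a \<Rightarrow> 'a \<Rightarrow> real) \<Rightarrow> ('w \<Rightarrow> enat) \<Rightarrow> (nat \<Rightarrow> 'w \<Rightarrow> 'a) \<Rightarrow> (nat \<times> nat \<Rightarrow> 'w \<Rightarrow> real) \<Rightarrow> 'a \<Rightarrow> 'w \<Rightarrow> 'a set" where
  "vertex_cluster \<phi> N X Z v \<omega> =
     component (rcm_edges \<phi> (eSuc (N \<omega>)) (case_nat v (\<lambda>n. X n \<omega>)) (\<lambda>e. Z e \<omega>)) v"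

definition expected_cluster_size ::
    "'w measure \<Rightarrow> ('a \<Rightarrow> 'a \<Rightarrow> real) \<Rightarrow> ('w \<Rightarrow> enat) \<Rightarrow> (nat \<Rightarrow> 'w \<Rightarrow> 'a) \<Rightarrow> (nat \<times> nat \<Rightarrow> 'w \<Rightarrow> real) \<Rightarrow> 'a \<Rightarrow> ennreal" where
  "expected_cluster_size M \<phi> N X Z v =
     (\<integral>\<^sup>+ \<omega>. emeasure (count_space UNIV) (vertex_cluster \<phi> N X Z v \<omega>) \<partial>M)"

definition D_phi :: "'a measure \<Rightarrow> ('a \<Rightarrow> 'a \<Rightarrow> real) \<Rightarrow> 'a \<Rightarrow> ennreal" where
  "D_phi \<Lambda> \<phi> v = (\<integral>\<^sup>+ y. ennreal (\<phi> v y) \<partial>\<Lambda>)"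

definition D_star :: "'a measure \<Rightarrow> ('a \<Rightarrow> 'a \<Rightarrow> real) \<Rightarrow> ennreal" where
  "D_star \<Lambda> \<phi> = esssup \<Lambda> (D_phi \<Lambda> \<phi>)"

text \<open>\<open>S t v\<close> stands for the expected cluster size of \<open>v\<close> at intensity \<open>t\<close>.\<close>

definition t_T :: "'a measure \<Rightarrow> (real \<Rightarrow> 'a \<Rightarrow> ennreal) \<Rightarrow> ennreal" where
  "t_T \<Lambda> S = Sup {ennreal t | t. 0 \<le> t \<and> esssup \<Lambda> (\<lambda>v. S t v) < \<infinity>}"

end

theory Submission
  imports Defs
begin

text \<open>
  The size of the cluster of \<open>v\<close> is at most the number of self-avoiding open paths from \<open>v\<close> and at
  least the degree of \<open>v\<close>, i.e. the number of such paths of length 1. Since the \<open>k\<close>-th factorial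
  moment measure of a Poisson process with diffuse intensity measure \<open>\<mu>\<close> is \<open>\<mu>\<^sup>k\<close>, and the edges
  of a self-avoiding path carry independent marks, the expected number of open paths of length \<open>k\<close> is the \<open>k\<close>-fold iterate of
  the kernel \<open>t \<phi>(x, y) \<lambda>(dy)\<close> applied to the constant 1. It is almost everywhere at most
  \<open>(t D\<^sup>*)\<^sup>k\<close>, so the expected cluster size is bounded by a geometric series if \<open>t D\<^sup>* < 1\<close>. For
  \<open>k = 1\<close> it equals \<open>t D(v)\<close>, so an essentially bounded expected cluster size at some \<open>t > 0\<close>
  forces \<open>D\<^sup>* < \<infinity>\<close>. The essential supremum of a non-measurable function is \<open>\<infinity>\<close> here, which is why
  the measurability of the expected cluster size in \<open>v\<close> matters.
\<close>

section \<open>Counts of a Poisson process\<close>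

text \<open>The mean of the Poisson distribution: the factor \<open>k\<close> cancels against the
  factorial, so the term at \<open>Suc k\<close> is \<open>m * exp (- m)\<close> times the
  \<open>k\<close>-th term of the exponential series, and the term at 0 vanishes.\<close>

lemma sums_poisson_mean:
  fixes m :: real
  shows "(\<lambda>k. real k * (m ^ k / fact k * exp (- m))) sums m"
proof -
  have "(\<lambda>k. m ^ k / fact k) sums exp m"
    using exp_converges[of m] by (simp add: divide_inverse mult.commute)
  then have "(\<lambda>k. (m * exp (- m)) * (m ^ k / fact k)) sums ((m * exp (- m)) * exp m)"
    by (rule sums_mult)
  moreover have "(m * exp (- m)) * exp m = m"
    by (simp add: mult.assoc flip: exp_add)
  moreover have "(m * exp (- m)) * (m ^ k / fact k) = real (Suc k) * (m ^ Suc k / fact (Suc k) * exp (- m))" for k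
    by (simp add: field_simps del: of_nat_Suc)
  ultimately have "(\<lambda>k. real (Suc k) * (m ^ Suc k / fact (Suc k) * exp (- m))) sums m"
    by (simp only:)
  then show ?thesis
    using sums_Suc[of "\<lambda>k. real k * (m ^ k / fact k * exp (- m))" m] by simp
qed

context simple_point_process
begin

lemmas [measurable] = number_measurable points_measurable

lemma point_count_eq_suminf:
  "point_count N X B \<omega> = (\<Sum>n. indicator {\<omega>. enat n < N \<omega> \<and> X n \<omega> \<in> B} \<omega>)"
proof -
  have "point_count N X B \<omega> =
      (\<integral>\<^sup>+ n. indicator {n. enat n < N \<omega> \<and> X n \<omega> \<in> B} n \<partial>count_space UNIV)"
    unfolding point_count_def by simp
  also have "\<dots> = (\<Sum>n. indicator {\<omega>. enat n < N \<omega> \<and> X n \<omega> \<in> B} \<omega>)"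
    by (subst nn_integral_count_space_nat) (auto intro!: arg_cong[where f = suminf] simp: fun_eq_iff indicator_def)
  finally show ?thesis .
qed

lemma point_count_measurable [measurable]:
  assumes [measurable]: "B \<in> sets borel"
  shows "point_count N X B \<in> borel_measurable M"
  unfolding point_count_eq_suminf[abs_def] by measurable

end

context poisson_process
begin

text \<open>Identifies \<open>\<mu>\<close> as the intensity measure. A set of finite measure may be
  unbounded, so almost sure finiteness of its count is read off from the Poisson weights, which add
  up to 1.\<close>

lemma nn_integral_point_count:
  assumes B [measurable]: "B \<in> sets borel"
  shows "(\<integral>\<^sup>+ \<omega>. point_count N X B \<omega> \<partial>M) = emeasure \<mu> B"
proof (cases "emeasure \<mu> B = \<infinity>")
  case True
  then have "(\<integral>\<^sup>+ \<omega>. point_count N X B \<omega> \<partial>M) = (\<integral>\<^sup>+ \<omega>. \<infinity> \<partial>M)"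
    using count_infinite[OF B] by (intro nn_integral_cong_AE) auto
  then show ?thesis
    using True by (simp add: emeasure_space_1)
next
  case False
  define m where "m = measure \<mu> B"
  define A where "A k = {\<omega> \<in> space M. point_count N X B \<omega> = of_nat k}" for k :: nat
  have [measurable]: "A k \<in> sets M" for k
    unfolding A_def by measurable
  have prob_A: "prob (A k) = m ^ k / fact k * exp (- m)" for k
    using count_finite[OF B, of k] False by (simp add: A_def m_def top.not_eq_extremum)
  have disj: "disjoint_family A"
    by (auto simp: disjoint_family_on_def A_def)
  have "(\<lambda>k. m ^ k / fact k * exp (- m)) sums (exp m * exp (- m))"
    using exp_converges[of m] by (intro sums_mult2) (simp add: divide_inverse mult.commute)
  then have "(\<lambda>k. prob (A k)) sums 1"
    by (simp add: prob_A exp_minus)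
  moreover have "(\<lambda>k. prob (A k)) sums prob (\<Union>k. A k)"
    using disj by (intro finite_measure_UNION) auto
  ultimately have "prob (\<Union>k. A k) = 1"
    using sums_unique2 by blast
  then have "AE \<omega> in M. \<omega> \<in> (\<Union>k. A k)"
    by (rule AE_prob_1)
  then have "(\<integral>\<^sup>+ \<omega>. point_count N X B \<omega> \<partial>M) = (\<integral>\<^sup>+ \<omega>. (\<Sum>k. of_nat k * indicator (A k) \<omega>) \<partial>M)"
  proof (intro nn_integral_cong_AE, eventually_elim)
    case (elim \<omega>)
    then obtain j where j: "\<omega> \<in> A j" by auto
    have "point_count N X B \<omega> = of_nat j"
      using j by (simp add: A_def)
    also have "\<dots> = (\<Sum>k\<in>{j}. of_nat k * indicator (A k) \<omega>)"
      using j by simp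
    also have "\<dots> = (\<Sum>k. of_nat k * indicator (A k) \<omega>)"
      using j by (intro suminf_finite[symmetric]) (auto simp: A_def indicator_def)
    finally show ?case .
  qed
  also have "\<dots> = (\<Sum>k. of_nat k * ennreal (prob (A k)))"
    by (simp add: nn_integral_suminf nn_integral_cmult_indicator emeasure_eq_measure)
  also have "\<dots> = (\<Sum>k. ennreal (real k * (m ^ k / fact k * exp (- m))))"
    by (simp add: prob_A ennreal_of_nat_eq_real_of_nat flip: ennreal_mult')
  also have "\<dots> = ennreal m"
    by (intro suminf_ennreal_eq sums_poisson_mean) (simp add: m_def)
  finally show ?thesis
    using False by (simp add: m_def emeasure_eq_ennreal_measure)
qed

lemma nn_integral_prod_point_count:
  fixes I :: "nat set"
  assumes "finite I" "disjoint_family_on B I" "\<And>i. i \<in> I \<Longrightarrow> B i \<in> sets borel"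
  shows "(\<integral>\<^sup>+ \<omega>. (\<Prod>i\<in>I. point_count N X (B i) \<omega>) \<partial>M) = (\<Prod>i\<in>I. emeasure \<mu> (B i))"
  using indep_vars_nn_integral[OF \<open>finite I\<close> count_indep[OF assms]] assms(3)
  by (simp add: nn_integral_point_count)

end

section \<open>Comparing measures on tuples through rectangles with disjoint sides\<close>

text \<open>
  The finite partition generated by the first \<open>j\<close> sets of a countable base eventually separates any
  finite set of distinct points, so a measure on tuples that charges only tuples of distinct points
  is determined on rectangles by the rectangles with disjoint sides.
\<close>

lemma emeasure_PiE_eq_of_disjoint:
  fixes P Q :: "('i \<Rightarrow> 'a::{second_countable_topology, t1_space}) measure"
  assumes I: "finite I"
    and sets_P: "sets P = sets (PiM I (\<lambda>_. borel))" and sets_Q: "sets Q = sets (PiM I (\<lambda>_. borel))"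
    and inj_P: "AE x in P. inj_on x I" and inj_Q: "AE x in Q. inj_on x I"
    and eq: "\<And>B. \<lbrakk>\<And>i. i \<in> I \<Longrightarrow> B i \<in> sets borel; disjoint_family_on B I\<rbrakk> \<Longrightarrow>
      emeasure P (PiE I B) = emeasure Q (PiE I B)"
    and A: "\<And>i. i \<in> I \<Longrightarrow> A i \<in> sets borel"
  shows "emeasure P (PiE I A) = emeasure Q (PiE I A)"
proof -
  obtain \<B> :: "'a set set" where \<B>: "countable \<B>" "topological_basis \<B>"
    using ex_countable_basis by blast
  have "\<B> \<noteq> {}"
    using \<B>(2) by (auto simp: topological_basis_def intro: exI[of _ UNIV])
  define U where "U = from_nat_into \<B>"
  have range_U: "range U = \<B>"
    unfolding U_def using \<B>(1) \<open>\<B> \<noteq> {}\<close> by (rule range_from_nat_into[rotated])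
  have open_U: "open (U i)" for i
    using \<B>(2) range_U by (metis rangeI topological_basis_open)
  have sep_U: "\<exists>i. x \<in> U i \<and> y \<notin> U i" if "x \<noteq> y" for x y
  proof -
    obtain V where V: "open V" "x \<in> V" "y \<notin> V" using separation_t1[of x y] \<open>x \<noteq> y\<close> by blast
    then obtain B where "B \<in> \<B>" "x \<in> B" "B \<subseteq> V"
      using \<B>(2) by (meson topological_basisE)
    then show ?thesis using range_U V by blast
  qed
  define code where "code j x = {i. i < j \<and> x \<in> U i}" for j :: nat and x
  have code_Pow: "code j x \<in> Pow {..<j}" for j x
    by (auto simp: code_def)
  have code_mono: "code j x \<noteq> code j y" if "code i x \<noteq> code i y" "i \<le> j" for i j x y
  proof -
    have "code i z = code j z \<inter> {..<i}" for z
      using \<open>i \<le> j\<close> by (auto simp: code_def)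
    with that show ?thesis by metis
  qed
  have cell: "{x. code j x = c} \<in> sets borel" if "c \<in> Pow {..<j}" for j c
  proof -
    have "code j x = c \<longleftrightarrow> (\<forall>i<j. x \<in> (if i \<in> c then U i else - U i))" for x
    proof -
      have "code j x = c \<longleftrightarrow> (\<forall>i<j. x \<in> U i \<longleftrightarrow> i \<in> c)"
        using that unfolding code_def by blast
      then show ?thesis by auto
    qed
    then have "{x. code j x = c} = (\<Inter>i\<in>{..<j}. if i \<in> c then U i else - U i)"
      by blast
    also have "\<dots> \<in> sets borel"
    \<comment> \<open>For \<open>j = 0\<close> the intersection is empty and denotes the whole
      space.\<close>
    proof (cases "j = 0")
      case False
      show ?thesis
        using open_U False by (intro sets.finite_INT) auto
    qed simp
    finally show ?thesis .
  qed
  \<comment> \<open>\<open>D j\<close> is the part of the rectangle whose coordinates are already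
    separated by the cells of level \<open>j\<close>. Sorting its tuples by their cells splits it
    into the finitely many rectangles \<open>R j c\<close>, whose sides are disjoint, so that the
    hypothesis on \<open>P\<close> and \<open>Q\<close> applies to each.\<close>
  define D where "D j = {x \<in> PiE I A. inj_on (\<lambda>i. code j (x i)) I}" for j
  define T where "T j = {c \<in> PiE I (\<lambda>_. Pow {..<j}). inj_on c I}" for j :: nat
  define R where "R j c = PiE I (\<lambda>i. A i \<inter> {x. code j x = c i})" for j c
  have fin_T: "finite (T j)" for j
    using I by (auto simp: T_def intro!: finite_PiE)
  have c_Pow: "c i \<in> Pow {..<j}" if "c \<in> T j" "i \<in> I" for c i j
    using that by (auto simp: T_def PiE_iff)
  have R_sets: "R j c \<in> sets (PiM I (\<lambda>_. borel))" if "c \<in> T j" for j c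
    unfolding R_def using that I A cell c_Pow by (intro sets_PiM_I_finite) auto
  have D_eq: "D j = (\<Union>c\<in>T j. R j c)" for j
  proof (intro equalityI subsetI)
    fix x assume x: "x \<in> D j"
    define c where "c = restrict (\<lambda>i. code j (x i)) I"
    have "inj_on c I"
      using x inj_on_cong[of I c "\<lambda>i. code j (x i)"] by (auto simp: D_def c_def)
    then have "c \<in> T j"
      using code_Pow by (auto simp: T_def c_def)
    moreover have "x \<in> R j c"
      using x by (auto simp: D_def R_def c_def PiE_iff)
    ultimately show "x \<in> (\<Union>c\<in>T j. R j c)" by blast
  next
    fix x assume "x \<in> (\<Union>c\<in>T j. R j c)"
    then obtain c where c: "c \<in> T j" "x \<in> R j c" by blast
    then have eq: "code j (x i) = c i" "x i \<in> A i" if "i \<in> I" for i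
      using that by (auto simp: R_def PiE_iff)
    have "inj_on (\<lambda>i. code j (x i)) I"
      using c(1) eq inj_on_cong[of I c "\<lambda>i. code j (x i)"] by (auto simp: T_def)
    then show "x \<in> D j"
      using eq c(2) by (auto simp: D_def R_def PiE_iff)
  qed
  have D_sets: "D j \<in> sets (PiM I (\<lambda>_. borel))" for j
    unfolding D_eq using fin_T R_sets by (intro sets.finite_UN) auto
  have disj: "disjoint_family_on (R j) (T j)" for j
  proof (unfold disjoint_family_on_def, safe)
    fix c c' x assume c: "c \<in> T j" "c' \<in> T j" "c \<noteq> c'" "x \<in> R j c" "x \<in> R j c'"
    then have "c = c'"
      by (intro PiE_ext[of c I "\<lambda>_. Pow {..<j}" c']) (auto simp: T_def R_def PiE_iff)
    with c show "x \<in> {}" by blast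
  qed
  have D_agree: "emeasure P (D j) = emeasure Q (D j)" for j
  proof -
    have "emeasure P (D j) = (\<Sum>c\<in>T j. emeasure P (R j c))"
      unfolding D_eq using fin_T disj R_sets sets_P by (intro sum_emeasure[symmetric]) auto
    also have "\<dots> = (\<Sum>c\<in>T j. emeasure Q (R j c))"
    proof (intro sum.cong refl)
      fix c assume c: "c \<in> T j"
      have "disjoint_family_on (\<lambda>i. A i \<inter> {x. code j x = c i}) I"
        using c by (auto simp: disjoint_family_on_def T_def inj_on_def)
      then show "emeasure P (R j c) = emeasure Q (R j c)"
        unfolding R_def using A cell c_Pow[OF c] by (intro eq) auto
    qed
    also have "\<dots> = emeasure Q (D j)"
      unfolding D_eq using fin_T disj R_sets sets_Q by (intro sum_emeasure) auto
    finally show ?thesis .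
  qed
  have D_incseq: "incseq D"
    unfolding incseq_def D_def inj_on_def using code_mono by blast
  have D_UN: "(\<Union>j. D j) = {x \<in> PiE I A. inj_on x I}"
  proof (intro equalityI subsetI)
    fix x assume "x \<in> (\<Union>j. D j)"
    then show "x \<in> {x \<in> PiE I A. inj_on x I}"
      by (auto simp: D_def inj_on_def)
  next
    fix x assume x: "x \<in> {x \<in> PiE I A. inj_on x I}"
    have "\<forall>i\<in>I. \<forall>l\<in>I. \<exists>j. i \<noteq> l \<longrightarrow> code j (x i) \<noteq> code j (x l)"
    proof (intro ballI)
      fix i l assume il: "i \<in> I" "l \<in> I"
      show "\<exists>j. i \<noteq> l \<longrightarrow> code j (x i) \<noteq> code j (x l)"
      proof (cases "i = l")
        case False
        then have "x i \<noteq> x l" using x il by (auto simp: inj_on_def)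
        then obtain n where "x i \<in> U n" "x l \<notin> U n" using sep_U by blast
        then have "n \<in> code (Suc n) (x i)" "n \<notin> code (Suc n) (x l)"
          by (auto simp: code_def)
        then show ?thesis by blast
      qed blast
    qed
    then obtain J where J: "\<And>i l. i \<in> I \<Longrightarrow> l \<in> I \<Longrightarrow> i \<noteq> l \<Longrightarrow> code (J i l) (x i) \<noteq> code (J i l) (x l)"
      by metis
    \<comment> \<open>Codes that differ at one level differ at all higher ones, so the largest of
      the finitely many separating levels serves all pairs. The 0 makes the maximum meaningful for
      empty \<open>I\<close>.\<close>
    define j where "j = Max (insert 0 ((\<lambda>(i, l). J i l) ` (I \<times> I)))"
    have "J i l \<le> j" if "i \<in> I" "l \<in> I" for i l
      unfolding j_def using I that by (intro Max_ge) auto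
    then have "code j (x i) \<noteq> code j (x l)" if "i \<in> I" "l \<in> I" "i \<noteq> l" for i l
      using code_mono[OF J] that by blast
    then have "x \<in> D j"
      using x by (auto simp: D_def inj_on_def)
    then show "x \<in> (\<Union>j. D j)" by blast
  qed
  have lim: "emeasure \<nu> (PiE I A) = (SUP j. emeasure \<nu> (D j))"
    if sets: "sets \<nu> = sets (PiM I (\<lambda>_. borel))" and inj: "AE x in \<nu>. inj_on x I" for \<nu> :: "('i \<Rightarrow> 'a) measure"
  proof -
    have "emeasure \<nu> (PiE I A) = emeasure \<nu> (\<Union>j. D j)"
    proof (rule emeasure_eq_AE)
      show "AE x in \<nu>. (x \<in> PiE I A) = (x \<in> (\<Union>j. D j))"
        using inj unfolding D_UN by eventually_elim auto
      show "PiE I A \<in> sets \<nu>"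
        unfolding sets using I A by (intro sets_PiM_I_finite) auto
      show "(\<Union>j. D j) \<in> sets \<nu>"
        unfolding sets using D_sets by (intro sets.countable_UN) auto
    qed
    also have "\<dots> = (SUP j. emeasure \<nu> (D j))"
      using D_sets D_incseq sets by (intro SUP_emeasure_incseq[symmetric]) auto
    finally show ?thesis .
  qed
  show ?thesis
    using lim[OF sets_P inj_P] lim[OF sets_Q inj_Q] D_agree by simp
qed

section \<open>Factorial moment measures\<close>

text \<open>For a fixed pair of indices, integrating over coordinate \<open>i\<close> first leaves
  the measure of the single point \<open>x l\<close>, which is 0. There are finitely many
  pairs.\<close>

lemma AE_inj_on_PiM:
  fixes \<mu> :: "'a::polish_space measure"
  assumes "sigma_finite_measure \<mu>" and sets_mu [measurable_cong]: "sets \<mu> = sets borel"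
    and diffuse: "\<And>x. emeasure \<mu> {x} = 0" and I: "finite I"
  shows "AE x in PiM I (\<lambda>_. \<mu>). inj_on x I"
proof -
  interpret product_sigma_finite "\<lambda>_. \<mu>"
    using assms(1) by (simp add: product_sigma_finite_def)
  have ne: "AE x in PiM I (\<lambda>_. \<mu>). x i \<noteq> x l" if "i \<in> I" "l \<in> I" "i \<noteq> l" for i l
  proof -
    define J where "J = I - {i}"
    have IJ: "I = insert i J" "i \<notin> J" "finite J" "l \<in> J"
      using that I by (auto simp: J_def)
    \<comment> \<open>The event that two coordinates agree is measurable as the zero set of their
      distance.\<close>
    have [measurable]: "(\<lambda>x. dist (x i) (x l)) \<in> borel_measurable (PiM (insert i J) (\<lambda>_. \<mu>))"
      using IJ by (intro borel_measurable_dist) (auto simp: measurable_cong_sets[OF refl sets_mu[symmetric]])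
    have "Measurable.pred (PiM (insert i J) (\<lambda>_. \<mu>)) (\<lambda>x. dist (x i) (x l) = 0)"
      by measurable
    then have [measurable]: "Measurable.pred (PiM (insert i J) (\<lambda>_. \<mu>)) (\<lambda>x. x i = x l)"
      by simp
    have m: "(\<lambda>x. of_bool (x i = x l) :: ennreal) \<in> borel_measurable (PiM (insert i J) (\<lambda>_. \<mu>))"
      by measurable
    have "(\<integral>\<^sup>+ x. of_bool (x i = x l) \<partial>PiM (insert i J) (\<lambda>_. \<mu>)) =
        (\<integral>\<^sup>+ x. (\<integral>\<^sup>+ y. of_bool ((x(i := y)) i = (x(i := y)) l) \<partial>\<mu>) \<partial>PiM J (\<lambda>_. \<mu>))"
      using IJ m by (intro product_nn_integral_insert) auto
    also have "\<dots> = (\<integral>\<^sup>+ x. (\<integral>\<^sup>+ y. indicator {x l} y \<partial>\<mu>) \<partial>PiM J (\<lambda>_. \<mu>))"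
      using that by (intro nn_integral_cong) (auto simp: indicator_def)
    also have "\<dots> = 0"
      using diffuse by (simp add: sets_mu)
    finally have "(\<integral>\<^sup>+ x. of_bool (x i = x l) \<partial>PiM (insert i J) (\<lambda>_. \<mu>)) = 0" .
    then have "AE x in PiM (insert i J) (\<lambda>_. \<mu>). (of_bool (x i = x l) :: ennreal) = 0"
      by (subst (asm) nn_integral_0_iff_AE[OF m])
    then show ?thesis
      unfolding IJ(1) by eventually_elim (auto simp: indicator_def)
  qed
  have "AE x in PiM I (\<lambda>_. \<mu>). \<forall>i\<in>I. \<forall>l\<in>I. i \<noteq> l \<longrightarrow> x i \<noteq> x l"
    using I ne by (auto intro!: AE_finite_allI)
  then show ?thesis
    by eventually_elim (auto simp: inj_on_def)
qed

locale diffuse_poisson_process = poisson_process M \<mu> N X + mu: sigma_finite_measure \<mu>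
  for M :: "'w measure" and \<mu> :: "'a::polish_space measure"
    and N :: "'w \<Rightarrow> enat" and X :: "nat \<Rightarrow> 'w \<Rightarrow> 'a" +
  assumes sets_mu [measurable_cong]: "sets \<mu> = sets borel"
    and diffuse: "\<And>x. emeasure \<mu> {x} = 0"
begin

lemma space_mu [simp]: "space \<mu> = UNIV"
  using sets_eq_imp_space_eq[OF sets_mu] by simp

sublocale mus: product_sigma_finite "\<lambda>_ :: nat. \<mu>"
  by (simp add: product_sigma_finite_def mu.sigma_finite_measure_axioms)

abbreviation tuples :: "nat set \<Rightarrow> (nat \<Rightarrow> nat) measure" where
  "tuples I \<equiv> count_space (PiE I (\<lambda>_. UNIV))"

text \<open>Distinctness is required of the indices. Since the process is simple, the points are
  then distinct almost surely.\<close>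

definition distinct_points :: "nat set \<Rightarrow> (nat \<Rightarrow> nat) \<Rightarrow> 'w \<Rightarrow> bool" where
  "distinct_points I p \<omega> \<longleftrightarrow> inj_on p I \<and> (\<forall>i\<in>I. enat (p i) < N \<omega>)"

definition point_tuple :: "nat set \<Rightarrow> (nat \<Rightarrow> nat) \<Rightarrow> 'w \<Rightarrow> nat \<Rightarrow> 'a" where
  "point_tuple I p \<omega> = (\<lambda>i\<in>I. X (p i) \<omega>)"

text \<open>The factorial moment measure of order \<open>card I\<close>, written as the image of
  counting measure times \<open>M\<close> under the evaluation of index tuples. Labelling
  coordinates by \<open>I\<close> makes it directly comparable with
  \<open>PiM I (\<lambda>_. \<mu>)\<close>.\<close>

definition factorial_moment :: "nat set \<Rightarrow> (nat \<Rightarrow> 'a) measure" where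
  "factorial_moment I =
    distr (density (tuples I \<Otimes>\<^sub>M M) (\<lambda>(p, \<omega>). of_bool (distinct_points I p \<omega>)))
      (PiM I (\<lambda>_. borel)) (\<lambda>(p, \<omega>). point_tuple I p \<omega>)"

lemma pred_distinct_points [measurable]:
  "finite I \<Longrightarrow> Measurable.pred M (\<lambda>\<omega>. distinct_points I p \<omega>)"
  unfolding distinct_points_def by measurable

lemma point_tuple_measurable [measurable]:
  "point_tuple I p \<in> M \<rightarrow>\<^sub>M PiM I (\<lambda>_. borel)"
  unfolding point_tuple_def by measurable

lemma countable_tuples: "finite I \<Longrightarrow> countable (PiE I (\<lambda>_. UNIV :: nat set))"
  by (intro countable_PiE) auto

lemma nn_integral_factorial_moment:
  assumes I: "finite I" and f [measurable]: "f \<in> borel_measurable (PiM I (\<lambda>_. borel))"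
  shows "(\<integral>\<^sup>+ x. f x \<partial>factorial_moment I) =
    (\<integral>\<^sup>+ p. (\<integral>\<^sup>+ \<omega>. of_bool (distinct_points I p \<omega>) * f (point_tuple I p \<omega>) \<partial>M) \<partial>tuples I)"
proof -
  note countable = countable_tuples[OF I]
  have [measurable]: "(\<lambda>(p, \<omega>). of_bool (distinct_points I p \<omega>) :: ennreal) \<in> borel_measurable (tuples I \<Otimes>\<^sub>M M)"
    using I by (intro measurable_pair_measure_countable1 countable) auto
  have [measurable]: "(\<lambda>(p, \<omega>). point_tuple I p \<omega>) \<in> tuples I \<Otimes>\<^sub>M M \<rightarrow>\<^sub>M PiM I (\<lambda>_. borel)"
    by (intro measurable_pair_measure_countable1 countable) auto
  have "(\<integral>\<^sup>+ x. f x \<partial>factorial_moment I) =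
      (\<integral>\<^sup>+ (p, \<omega>). of_bool (distinct_points I p \<omega>) * f (point_tuple I p \<omega>) \<partial>(tuples I \<Otimes>\<^sub>M M))"
    unfolding factorial_moment_def
    by (simp add: nn_integral_distr nn_integral_density split_beta')
  also have "\<dots> = (\<integral>\<^sup>+ p. (\<integral>\<^sup>+ \<omega>. of_bool (distinct_points I p \<omega>) * f (point_tuple I p \<omega>) \<partial>M) \<partial>tuples I)"
    by (subst nn_integral_fst[symmetric]) auto
  finally show ?thesis .
qed

lemma AE_inj_on_factorial_moment:
  assumes I: "finite I"
  shows "AE x in factorial_moment I. inj_on x I"
proof -
  have [measurable]: "Measurable.pred (PiM I (\<lambda>_. borel)) (\<lambda>x :: nat \<Rightarrow> 'a. \<forall>i\<in>I. \<forall>l\<in>I. i \<noteq> l \<longrightarrow> dist (x i) (x l) \<noteq> 0)"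
    using I by measurable
  have inj: "inj_on x I \<longleftrightarrow> (\<forall>i\<in>I. \<forall>l\<in>I. i \<noteq> l \<longrightarrow> dist (x i) (x l) \<noteq> 0)" for x :: "nat \<Rightarrow> 'a"
    by (auto simp: inj_on_def)
  have [measurable]: "(\<lambda>x :: nat \<Rightarrow> 'a. of_bool (\<not> inj_on x I) :: ennreal) \<in> borel_measurable (PiM I (\<lambda>_. borel))"
    unfolding inj by measurable
  have "(\<integral>\<^sup>+ \<omega>. of_bool (distinct_points I p \<omega>) * of_bool (\<not> inj_on (point_tuple I p \<omega>) I) \<partial>M) = (\<integral>\<^sup>+ \<omega>. 0 \<partial>M)" for p
    using simple
  proof (intro nn_integral_cong_AE, eventually_elim)
    case (elim \<omega>)
    show ?case
      using elim by (auto simp: distinct_points_def point_tuple_def inj_on_def)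
  qed
  then have "(\<integral>\<^sup>+ x. of_bool (\<not> inj_on x I) \<partial>factorial_moment I) = 0"
    by (subst nn_integral_factorial_moment[OF I]) auto
  then have "AE x in factorial_moment I. (of_bool (\<not> inj_on x I) :: ennreal) = 0"
    by (subst (asm) nn_integral_0_iff_AE) (auto simp: factorial_moment_def)
  then show ?thesis
    by eventually_elim auto
qed

text \<open>Points in disjoint sets have different indices, so the restriction to distinct indices
  is automatic here. The sum over index tuples then factorises into the counts of the sides, which
  are independent.\<close>

lemma emeasure_factorial_moment_disjoint:
  assumes I: "finite I" and B: "\<And>i. i \<in> I \<Longrightarrow> B i \<in> sets borel" and disj: "disjoint_family_on B I"
  shows "emeasure (factorial_moment I) (PiE I B) = (\<Prod>i\<in>I. emeasure \<mu> (B i))"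
proof -
  define S where "S i \<omega> = {n. enat n < N \<omega> \<and> X n \<omega> \<in> B i}" for i \<omega>
  have [measurable]: "PiE I B \<in> sets (PiM I (\<lambda>_. borel))"
    using I B by (intro sets_PiM_I_finite) auto
  have B': "i \<in> I \<Longrightarrow> Measurable.pred borel (\<lambda>x. x \<in> B i)" for i
    using B by (simp add: pred_def)
  interpret C: product_sigma_finite "\<lambda>_ :: nat. count_space (UNIV :: nat set)"
    by (simp add: product_sigma_finite_def sigma_finite_measure_count_space)
  interpret P: pair_sigma_finite "tuples I" M
    using countable_tuples[OF I]
    by (intro pair_sigma_finite.intro sigma_finite_measure_count_space_countable sigma_finite_measure_axioms)
  have prod: "of_bool (distinct_points I p \<omega>) * indicator (PiE I B) (point_tuple I p \<omega>) =
      (\<Prod>i\<in>I. indicator (S i \<omega>) (p i) :: ennreal)" if "p \<in> PiE I (\<lambda>_. UNIV)" for p \<omega>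
  proof (cases "\<forall>i\<in>I. p i \<in> S i \<omega>")
    case True
    have "inj_on p I"
    proof (rule inj_onI, rule ccontr)
      fix i l assume il: "i \<in> I" "l \<in> I" "p i = p l" "i \<noteq> l"
      then have "X (p i) \<omega> \<in> B i \<inter> B l"
        using True by (auto simp: S_def)
      with il disj show False
        by (auto simp: disjoint_family_on_def)
    qed
    with True show ?thesis
      by (auto simp: distinct_points_def S_def point_tuple_def)
  next
    case False
    then obtain i where i: "i \<in> I" "p i \<notin> S i \<omega>" by blast
    then have "(\<Prod>i\<in>I. indicator (S i \<omega>) (p i) :: ennreal) = 0"
      using I by (intro prod_zero) (auto simp: indicator_def)
    moreover have "\<not> (distinct_points I p \<omega> \<and> point_tuple I p \<omega> \<in> PiE I B)"
      using i by (auto simp: distinct_points_def S_def point_tuple_def PiE_iff)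
    ultimately show ?thesis by auto
  qed
  have "(\<lambda>\<omega>. \<Prod>i\<in>I. indicator (S i \<omega>) (p i) :: ennreal) \<in> borel_measurable M" for p
  proof (rule borel_measurable_prod_ennreal)
    fix i assume "i \<in> I"
    note B'[OF this, measurable]
    have "(\<lambda>\<omega>. indicator (S i \<omega>) (p i) :: ennreal) = (\<lambda>\<omega>. of_bool (enat (p i) < N \<omega> \<and> X (p i) \<omega> \<in> B i))"
      by (auto simp: S_def indicator_def)
    also have "\<dots> \<in> borel_measurable M"
      by measurable
    finally show "(\<lambda>\<omega>. indicator (S i \<omega>) (p i) :: ennreal) \<in> borel_measurable M" .
  qed
  then have m: "(\<lambda>(p, \<omega>). \<Prod>i\<in>I. indicator (S i \<omega>) (p i) :: ennreal) \<in> borel_measurable (tuples I \<Otimes>\<^sub>M M)"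
    by (intro measurable_pair_measure_countable1 countable_tuples I) simp
  have "emeasure (factorial_moment I) (PiE I B) = (\<integral>\<^sup>+ x. indicator (PiE I B) x \<partial>factorial_moment I)"
    by (subst nn_integral_indicator) (auto simp: factorial_moment_def)
  also have "\<dots> = (\<integral>\<^sup>+ p. (\<integral>\<^sup>+ \<omega>. (\<Prod>i\<in>I. indicator (S i \<omega>) (p i)) \<partial>M) \<partial>tuples I)"
    by (subst nn_integral_factorial_moment[OF I]) (auto intro!: nn_integral_cong simp: prod)
  also have "\<dots> = (\<integral>\<^sup>+ \<omega>. (\<integral>\<^sup>+ p. (\<Prod>i\<in>I. indicator (S i \<omega>) (p i)) \<partial>tuples I) \<partial>M)"
    using P.Fubini'[OF m] by simp
  also have "\<dots> = (\<integral>\<^sup>+ \<omega>. (\<Prod>i\<in>I. point_count N X (B i) \<omega>) \<partial>M)"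
  proof (intro nn_integral_cong)
    fix \<omega>
    \<comment> \<open>For finite \<open>I\<close>, counting measure on tuples is a product of
      counting measures, so the integral of the product is the product of the integrals.\<close>
    have "(\<integral>\<^sup>+ p. (\<Prod>i\<in>I. indicator (S i \<omega>) (p i)) \<partial>tuples I) =
        (\<integral>\<^sup>+ p. (\<Prod>i\<in>I. indicator (S i \<omega>) (p i)) \<partial>PiM I (\<lambda>_. count_space UNIV))"
      using I by (simp add: count_space_PiM_finite)
    also have "\<dots> = (\<Prod>i\<in>I. \<integral>\<^sup>+ n. indicator (S i \<omega>) n \<partial>count_space UNIV)"
      using I by (intro C.product_nn_integral_prod) auto
    also have "\<dots> = (\<Prod>i\<in>I. point_count N X (B i) \<omega>)"
      by (simp add: point_count_def S_def)
    finally show "(\<integral>\<^sup>+ p. (\<Prod>i\<in>I. indicator (S i \<omega>) (p i)) \<partial>tuples I) = (\<Prod>i\<in>I. point_count N X (B i) \<omega>)" .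
  qed
  also have "\<dots> = (\<Prod>i\<in>I. emeasure \<mu> (B i))"
    using assms by (intro nn_integral_prod_point_count) auto
  finally show ?thesis .
qed

text \<open>Both measures charge only injective tuples, one because the process is simple and the
  other because \<open>\<mu>\<close> is diffuse. Agreement on rectangles with disjoint sides is
  therefore enough.\<close>

lemma factorial_moment_eq_PiM:
  assumes I: "finite I"
  shows "factorial_moment I = PiM I (\<lambda>_. \<mu>)"
proof (rule mus.PiM_eqI[OF I])
  have sets_PiM: "sets (PiM I (\<lambda>_. \<mu>)) = sets (PiM I (\<lambda>_. borel))"
    by (intro sets_PiM_cong) (auto simp: sets_mu)
  show "sets (factorial_moment I) = sets (PiM I (\<lambda>_. \<mu>))"
    by (simp add: factorial_moment_def sets_PiM)
  fix A :: "nat \<Rightarrow> 'a set" assume A: "\<And>i. i \<in> I \<Longrightarrow> A i \<in> sets \<mu>"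
  have "emeasure (factorial_moment I) (PiE I A) = emeasure (PiM I (\<lambda>_. \<mu>)) (PiE I A)"
  proof (rule emeasure_PiE_eq_of_disjoint[OF I])
    show "AE x in PiM I (\<lambda>_. \<mu>). inj_on x I"
      using mu.sigma_finite_measure_axioms sets_mu diffuse I by (rule AE_inj_on_PiM)
    fix B :: "nat \<Rightarrow> 'a set"
    assume B: "\<And>i. i \<in> I \<Longrightarrow> B i \<in> sets borel" and disj: "disjoint_family_on B I"
    show "emeasure (factorial_moment I) (PiE I B) = emeasure (PiM I (\<lambda>_. \<mu>)) (PiE I B)"
      using emeasure_factorial_moment_disjoint[OF I B disj] mus.emeasure_PiM[OF I, of B] B
      by (simp add: sets_mu)
  qed (use A AE_inj_on_factorial_moment[OF I] in \<open>auto simp: factorial_moment_def sets_PiM sets_mu\<close>)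
  also have "\<dots> = (\<Prod>i\<in>I. emeasure \<mu> (A i))"
    using A I by (intro mus.emeasure_PiM) auto
  finally show "emeasure (factorial_moment I) (PiE I A) = (\<Prod>i\<in>I. emeasure \<mu> (A i))" .
qed

end

section \<open>Independent edge marks\<close>

lemma emeasure_count_space_image_le:
  "emeasure (count_space UNIV) (f ` A) \<le> emeasure (count_space UNIV) A"
proof (cases "finite A")
  case True
  then show ?thesis by (simp add: card_image_le)
qed simp

lemma emeasure_count_space_image:
  assumes "inj_on f A"
  shows "emeasure (count_space UNIV) (f ` A) = emeasure (count_space UNIV) A"
proof (cases "finite A")
  case True
  then show ?thesis using assms by (simp add: card_image)
next
  case False
  then show ?thesis using assms by (simp add: finite_image_iff)
qed

context poisson_rcm
begin

lemma mark_measurable [measurable]: "e \<in> mark_pairs \<Longrightarrow> Z e \<in> M \<rightarrow>\<^sub>M borel"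
  using marks_indep by (auto simp: indep_vars_def2)

lemma prob_mark_le:
  assumes e: "e \<in> mark_pairs" and c: "0 \<le> c" "c \<le> 1"
  shows "prob {\<omega> \<in> space M. Z e \<omega> \<le> c} = c"
proof -
  note [measurable] = mark_measurable[OF e]
  have "emeasure M {\<omega> \<in> space M. Z e \<omega> \<le> c} = emeasure (distr M borel (Z e)) {..c}"
    by (subst emeasure_distr) (auto intro!: arg_cong[where f = "emeasure M"])
  also have "\<dots> = emeasure lborel ({0..1} \<inter> {..c}) / emeasure lborel {0..1::real}"
    by (simp add: marks_uniform[OF e])
  also have "{0..1} \<inter> {..c} = {0..c}"
    using c by auto
  also have "emeasure lborel {0..c} / emeasure lborel {0..1::real} = ennreal c"
    using c by (simp add: divide_ennreal_def)
  finally show ?thesis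
    using c by (simp add: measure_def)
qed

text \<open>Injectivity of \<open>e\<close> means that no mark is consulted twice, so independence
  turns the joint probability into a product of uniform distribution functions.\<close>

lemma nn_integral_marks_le:
  assumes J: "finite J" "inj_on e J" "e ` J \<subseteq> mark_pairs" and c: "\<And>i. i \<in> J \<Longrightarrow> 0 \<le> c i \<and> c i \<le> 1"
  shows "(\<integral>\<^sup>+ \<omega>. of_bool (\<forall>i\<in>J. Z (e i) \<omega> \<le> c i) \<partial>M) = (\<Prod>i\<in>J. ennreal (c i))"
proof (cases "J = {}")
  case True
  then show ?thesis by (simp add: emeasure_space_1)
next
  case False
  have meas: "i \<in> J \<Longrightarrow> Z (e i) \<in> M \<rightarrow>\<^sub>M borel" for i
    using J by (intro mark_measurable) auto
  \<comment> \<open>Independence is stated for families indexed by edges, so the thresholds are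
    transported from positions to edges.\<close>
  define c' where "c' = c \<circ> the_inv_into J e"
  have c': "c' (e i) = c i" if "i \<in> J" for i
    using that J by (simp add: c'_def the_inv_into_f_f)
  have "(\<integral>\<^sup>+ \<omega>. of_bool (\<forall>i\<in>J. Z (e i) \<omega> \<le> c i) \<partial>M) =
      (\<integral>\<^sup>+ \<omega>. indicator (\<Inter>y\<in>e ` J. Z y -` {..c' y} \<inter> space M) \<omega> \<partial>M)"
    using False by (intro nn_integral_cong) (auto simp: c' indicator_def)
  also have "\<dots> = emeasure M (\<Inter>y\<in>e ` J. Z y -` {..c' y} \<inter> space M)"
    using J False by (intro nn_integral_indicator sets.finite_INT) (auto intro!: measurable_sets[OF meas])
  also have "\<dots> = ennreal (\<Prod>y\<in>e ` J. prob (Z y -` {..c' y} \<inter> space M))"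
    unfolding emeasure_eq_measure
    using J False by (subst indep_varsD[OF marks_indep]) auto
  also have "(\<Prod>y\<in>e ` J. prob (Z y -` {..c' y} \<inter> space M)) = (\<Prod>i\<in>J. prob (Z (e i) -` {..c' (e i)} \<inter> space M))"
    using J(2) by (subst prod.reindex) auto
  also have "\<dots> = (\<Prod>i\<in>J. c i)"
  proof (intro prod.cong refl)
    fix i assume i: "i \<in> J"
    have "Z (e i) -` {..c' (e i)} \<inter> space M = {\<omega> \<in> space M. Z (e i) \<omega> \<le> c i}"
      using i by (auto simp: c')
    then show "prob (Z (e i) -` {..c' (e i)} \<inter> space M) = c i"
      using i J c by (simp add: prob_mark_le image_subset_iff)
  qed
  also have "ennreal (\<Prod>i\<in>J. c i) = (\<Prod>i\<in>J. ennreal (c i))"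
    using c by (simp add: prod_ennreal)
  finally show ?thesis .
qed

text \<open>Independence of points and marks makes their joint law a product measure. By Fubini the
  points can be frozen at \<open>\<omega>\<close> while the marks are averaged over an independent
  copy \<open>\<omega>'\<close>.\<close>

lemma nn_integral_points_marks:
  assumes f [measurable]: "(\<lambda>((n, x), z). f n x z) \<in> borel_measurable
    ((count_space UNIV \<Otimes>\<^sub>M PiM UNIV (\<lambda>_. borel)) \<Otimes>\<^sub>M PiM mark_pairs (\<lambda>_. borel))"
  shows "(\<integral>\<^sup>+ \<omega>. f (N \<omega>) (\<lambda>n. X n \<omega>) (\<lambda>e\<in>mark_pairs. Z e \<omega>) \<partial>M) =
    (\<integral>\<^sup>+ \<omega>. (\<integral>\<^sup>+ \<omega>'. f (N \<omega>) (\<lambda>n. X n \<omega>) (\<lambda>e\<in>mark_pairs. Z e \<omega>') \<partial>M) \<partial>M)"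
proof -
  let ?S = "count_space UNIV \<Otimes>\<^sub>M PiM UNIV (\<lambda>_. borel) :: (enat \<times> (nat \<Rightarrow> 'a)) measure"
  let ?T = "PiM mark_pairs (\<lambda>_. borel) :: (nat \<times> nat \<Rightarrow> real) measure"
  define W where "W \<omega> = (N \<omega>, \<lambda>n. X n \<omega>)" for \<omega>
  define V where "V \<omega> = (\<lambda>e\<in>mark_pairs. Z e \<omega>)" for \<omega>
  have "(\<lambda>\<omega>. \<lambda>n\<in>UNIV. X n \<omega>) \<in> M \<rightarrow>\<^sub>M PiM UNIV (\<lambda>_. borel)"
    by (intro measurable_restrict points_measurable)
  then have "(\<lambda>\<omega> n. X n \<omega>) \<in> M \<rightarrow>\<^sub>M PiM UNIV (\<lambda>_. borel)"
    by (simp only: restrict_UNIV)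
  with number_measurable have W [measurable]: "W \<in> M \<rightarrow>\<^sub>M ?S"
    unfolding W_def by (rule measurable_Pair)
  have V [measurable]: "V \<in> M \<rightarrow>\<^sub>M ?T"
    unfolding V_def by (intro measurable_restrict mark_measurable)
  interpret S: prob_space "distr M ?S W"
    using W by (rule prob_space_distr)
  interpret T: prob_space "distr M ?T V"
    using V by (rule prob_space_distr)
  have distr: "distr M ?S W \<Otimes>\<^sub>M distr M ?T V = distr M (?S \<Otimes>\<^sub>M ?T) (\<lambda>\<omega>. (W \<omega>, V \<omega>))"
  proof (rule pair_measure_eqI)
    fix A B assume "A \<in> sets (distr M ?S W)" "B \<in> sets (distr M ?T V)"
    then have [measurable]: "A \<in> sets ?S" "B \<in> sets ?T" by auto
    have "emeasure (distr M (?S \<Otimes>\<^sub>M ?T) (\<lambda>\<omega>. (W \<omega>, V \<omega>))) (A \<times> B) =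
        prob ((W -` A \<inter> space M) \<inter> (V -` B \<inter> space M))"
      by (subst emeasure_distr) (auto simp: emeasure_eq_measure intro!: arg_cong[where f = prob])
    also have "prob ((W -` A \<inter> space M) \<inter> (V -` B \<inter> space M)) = prob (W -` A \<inter> space M) * prob (V -` B \<inter> space M)"
      using marks_indep_points
      by (rule indep_setD) (auto simp: sets_vimage_algebra W_def[abs_def] V_def[abs_def] intro!: sigma_sets.Basic)
    finally show "emeasure (distr M ?S W) A * emeasure (distr M ?T V) B =
        emeasure (distr M (?S \<Otimes>\<^sub>M ?T) (\<lambda>\<omega>. (W \<omega>, V \<omega>))) (A \<times> B)"
      by (simp add: emeasure_distr emeasure_eq_measure ennreal_mult)
  qed (simp_all add: S.sigma_finite_measure_axioms T.sigma_finite_measure_axioms cong: sets_pair_measure_cong)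
  define g where "g = (\<lambda>((n, x), z). f n x z)"
  have [measurable]: "g \<in> borel_measurable (?S \<Otimes>\<^sub>M ?T)"
    using f by (simp add: g_def)
  have [measurable]: "g \<in> borel_measurable (distr M ?S W \<Otimes>\<^sub>M distr M ?T V)"
    by measurable
  have "(\<integral>\<^sup>+ \<omega>. g (W \<omega>, V \<omega>) \<partial>M) = (\<integral>\<^sup>+ x. g x \<partial>distr M (?S \<Otimes>\<^sub>M ?T) (\<lambda>\<omega>. (W \<omega>, V \<omega>)))"
    by (subst nn_integral_distr) auto
  also have "\<dots> = (\<integral>\<^sup>+ w. (\<integral>\<^sup>+ z. g (w, z) \<partial>distr M ?T V) \<partial>distr M ?S W)"
    unfolding distr[symmetric] by (subst T.nn_integral_fst) auto
  also have "\<dots> = (\<integral>\<^sup>+ \<omega>. (\<integral>\<^sup>+ z. g (W \<omega>, z) \<partial>distr M ?T V) \<partial>M)"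
    by (subst nn_integral_distr) auto
  also have "\<dots> = (\<integral>\<^sup>+ \<omega>. (\<integral>\<^sup>+ \<omega>'. g (W \<omega>, V \<omega>') \<partial>M) \<partial>M)"
    by (intro nn_integral_cong, subst nn_integral_distr) (auto simp: W_def space_pair_measure space_PiM)
  finally show ?thesis
    by (simp add: g_def W_def V_def)
qed

end

section \<open>The integral operator of the connection function and its iterates\<close>

locale diffuse_poisson_rcm = poisson_rcm M \<mu> N X Z + diffuse_poisson_process M \<mu> N X
  for M :: "'w measure" and \<mu> :: "'a::polish_space measure"
    and N :: "'w \<Rightarrow> enat" and X :: "nat \<Rightarrow> 'w \<Rightarrow> 'a" and Z :: "nat \<times> nat \<Rightarrow> 'w \<Rightarrow> real" +
  fixes \<phi> :: "'a \<Rightarrow> 'a \<Rightarrow> real"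
  assumes phi_measurable: "(\<lambda>(x, y). \<phi> x y) \<in> borel_measurable (borel \<Otimes>\<^sub>M borel)"
    and phi_range: "\<And>x y. 0 \<le> \<phi> x y \<and> \<phi> x y \<le> 1"
begin

lemma phi_measurable_compose [measurable (raw)]:
  "f \<in> A \<rightarrow>\<^sub>M borel \<Longrightarrow> g \<in> A \<rightarrow>\<^sub>M borel \<Longrightarrow> (\<lambda>x. \<phi> (f x) (g x)) \<in> borel_measurable A"
  using measurable_compose[OF measurable_Pair phi_measurable] by simp

definition kernel :: "('a \<Rightarrow> ennreal) \<Rightarrow> 'a \<Rightarrow> ennreal" where
  "kernel g v = (\<integral>\<^sup>+ y. ennreal (\<phi> v y) * g y \<partial>\<mu>)"

lemma kernel_measurable [measurable]:
  assumes [measurable]: "g \<in> borel_measurable borel"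
  shows "kernel g \<in> borel_measurable borel"
proof -
  have [measurable]: "g \<in> borel_measurable \<mu>"
    by (simp add: measurable_cong_sets[OF sets_mu])
  show ?thesis
    unfolding kernel_def by measurable
qed

lemma funpow_kernel_measurable [measurable]:
  "g \<in> borel_measurable borel \<Longrightarrow> (kernel ^^ k) g \<in> borel_measurable borel"
  by (induction k) auto

text \<open>In a tuple \<open>x\<close> of points on a path from \<open>v\<close>, the predecessor of \<open>x i\<close> is \<open>case_nat v x i\<close>.\<close>

definition path_weight :: "nat \<Rightarrow> 'a \<Rightarrow> (nat \<Rightarrow> 'a) \<Rightarrow> ennreal" where
  "path_weight k v x = (\<Prod>i<k. ennreal (\<phi> (case_nat v x i) (x i)))"

lemma case_nat_component_measurable:
  "i \<le> k \<Longrightarrow> (\<lambda>x. case_nat v x i) \<in> PiM {..<k} (\<lambda>_. borel) \<rightarrow>\<^sub>M borel"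
  by (cases i) (auto intro: measurable_component_singleton)

lemma path_weight_measurable [measurable]:
  "path_weight k v \<in> borel_measurable (PiM {..<k} (\<lambda>_. borel))"
  unfolding path_weight_def
proof (rule borel_measurable_prod_ennreal)
  fix i assume "i \<in> {..<k}"
  then show "(\<lambda>x. ennreal (\<phi> (case_nat v x i) (x i))) \<in> borel_measurable (PiM {..<k} (\<lambda>_. borel))"
    by (intro measurable_compose[OF _ measurable_ennreal] phi_measurable_compose
        case_nat_component_measurable measurable_component_singleton) auto
qed

text \<open>Integrating out the last point replaces \<open>g\<close> there by
  \<open>kernel g\<close> at its predecessor and shortens the path by one. The arbitrary end factor
  \<open>g\<close> is what the induction has to carry.\<close>

lemma nn_integral_path_weight_mult:
  assumes "g \<in> borel_measurable borel"
  shows "(\<integral>\<^sup>+ x. path_weight k v x * g (case_nat v x k) \<partial>PiM {..<k} (\<lambda>_. \<mu>)) = (kernel ^^ k) g v"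
  using assms
proof (induction k arbitrary: g)
  case 0
  then show ?case
    by (simp add: path_weight_def PiM_empty)
next
  case (Suc k)
  note [measurable] = Suc.prems
  have sets_PiM: "sets (PiM I (\<lambda>_. \<mu>)) = sets (PiM I (\<lambda>_. borel))" for I :: "nat set"
    by (intro sets_PiM_cong) (auto simp: sets_mu)
  have m: "(\<lambda>x. path_weight (Suc k) v x * g (case_nat v x (Suc k))) \<in> borel_measurable (PiM (insert k {..<k}) (\<lambda>_. \<mu>))"
    unfolding lessThan_Suc[symmetric] measurable_cong_sets[OF sets_PiM refl]
    by (intro borel_measurable_times_ennreal path_weight_measurable
        measurable_compose[OF case_nat_component_measurable Suc.prems]) auto
  have "(\<integral>\<^sup>+ x. path_weight (Suc k) v x * g (case_nat v x (Suc k)) \<partial>PiM {..<Suc k} (\<lambda>_. \<mu>)) =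
      (\<integral>\<^sup>+ x. (\<integral>\<^sup>+ y. path_weight (Suc k) v (x(k := y)) * g (case_nat v (x(k := y)) (Suc k)) \<partial>\<mu>)
        \<partial>PiM {..<k} (\<lambda>_. \<mu>))"
    unfolding lessThan_Suc using m by (intro mus.product_nn_integral_insert) auto
  also have "\<dots> = (\<integral>\<^sup>+ x. path_weight k v x * kernel g (case_nat v x k) \<partial>PiM {..<k} (\<lambda>_. \<mu>))"
  proof (intro nn_integral_cong)
    fix x :: "nat \<Rightarrow> 'a"
    have pred: "case_nat v (x(k := y)) i = case_nat v x i" if "i \<le> k" for i y
      using that by (auto split: nat.split)
    have "path_weight (Suc k) v (x(k := y)) * g (case_nat v (x(k := y)) (Suc k)) =
        path_weight k v x * (ennreal (\<phi> (case_nat v x k) y) * g y)" for y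
      by (simp add: path_weight_def pred mult.assoc)
    moreover have [measurable]: "g \<in> borel_measurable \<mu>"
      by (simp add: measurable_cong_sets[OF sets_mu])
    ultimately show "(\<integral>\<^sup>+ y. path_weight (Suc k) v (x(k := y)) * g (case_nat v (x(k := y)) (Suc k)) \<partial>\<mu>) =
        path_weight k v x * kernel g (case_nat v x k)"
      by (simp add: kernel_def nn_integral_cmult)
  qed
  also have "\<dots> = (kernel ^^ k) (kernel g) v"
    by (intro Suc.IH) measurable
  finally show ?case
    by (simp add: funpow_swap1)
qed

lemma nn_integral_path_weight:
  "(\<integral>\<^sup>+ x. path_weight k v x \<partial>PiM {..<k} (\<lambda>_. \<mu>)) = (kernel ^^ k) (\<lambda>_. 1) v"
  using nn_integral_path_weight_mult[of "\<lambda>_. 1" k v] by simp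

text \<open>In the induction the previous bound is used only under an integral against
  \<open>\<mu>\<close>, so its exceptional null set does no harm.\<close>

lemma AE_funpow_kernel_le:
  assumes "AE v in \<mu>. kernel (\<lambda>_. 1) v \<le> d"
  shows "AE v in \<mu>. (kernel ^^ k) (\<lambda>_. 1) v \<le> d ^ k"
proof (induction k)
  case (Suc k)
  have m: "(\<lambda>y. ennreal (\<phi> v y)) \<in> borel_measurable \<mu>" for v
    by (simp add: measurable_cong_sets[OF sets_mu])
  from assms show ?case
  proof eventually_elim
    case (elim v)
    have "(kernel ^^ Suc k) (\<lambda>_. 1) v = (\<integral>\<^sup>+ y. ennreal (\<phi> v y) * (kernel ^^ k) (\<lambda>_. 1) y \<partial>\<mu>)"
      by (simp add: kernel_def)
    also have "\<dots> \<le> (\<integral>\<^sup>+ y. ennreal (\<phi> v y) * d ^ k \<partial>\<mu>)"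
    proof (rule nn_integral_mono_AE)
      show "AE y in \<mu>. ennreal (\<phi> v y) * (kernel ^^ k) (\<lambda>_. 1) y \<le> ennreal (\<phi> v y) * d ^ k"
        using Suc.IH by eventually_elim (simp add: mult_left_mono)
    qed
    also have "\<dots> = kernel (\<lambda>_. 1) v * d ^ k"
      using m by (simp add: kernel_def nn_integral_multc)
    also have "\<dots> \<le> d ^ Suc k"
      using elim by (auto intro: mult_right_mono)
    finally show ?case .
  qed
qed simp

end

section \<open>Open paths and clusters\<close>

context diffuse_poisson_rcm
begin

text \<open>
  Vertex \<open>0\<close> is the added point \<open>v\<close>, vertex \<open>Suc n\<close> is the point \<open>X n\<close>.
\<close>

definition vertex :: "'a \<Rightarrow> 'w \<Rightarrow> nat \<Rightarrow> 'a" where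
  "vertex v \<omega> = case_nat v (\<lambda>n. X n \<omega>)"

text \<open>A copy of the random connection model on indices. Its vertices lie in a fixed countable
  set, so measurability holds without exceptional sets; the copy is faithful whenever the vertices
  are distinct points.\<close>

definition index_edges :: "'a \<Rightarrow> 'w \<Rightarrow> (nat \<times> nat) set" where
  "index_edges v \<omega> = {(m, n). m \<noteq> n \<and> enat m < eSuc (N \<omega>) \<and> enat n < eSuc (N \<omega>) \<and>
     Z (min m n, max m n) \<omega> \<le> \<phi> (vertex v \<omega> m) (vertex v \<omega> n)}"

definition index_cluster :: "'a \<Rightarrow> 'w \<Rightarrow> nat set" where
  "index_cluster v \<omega> = {n. (0, n) \<in> (index_edges v \<omega>)\<^sup>*}"

text \<open>A tuple \<open>p\<close> of points stands for the path with vertices \<open>0, Suc (p 0), Suc (p 1), \<dots>\<close>.\<close>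

definition path_vertex :: "(nat \<Rightarrow> nat) \<Rightarrow> nat \<Rightarrow> nat" where
  "path_vertex p = case_nat 0 (\<lambda>i. Suc (p i))"

definition open_path :: "nat \<Rightarrow> 'a \<Rightarrow> (nat \<Rightarrow> nat) \<Rightarrow> 'w \<Rightarrow> bool" where
  "open_path k v p \<omega> \<longleftrightarrow> distinct_points {..<k} p \<omega> \<and>
     (\<forall>i<k. (path_vertex p i, path_vertex p (Suc i)) \<in> index_edges v \<omega>)"

text \<open>The smaller index comes first because marks are attached to pairs in
  \<open>mark_pairs\<close>.\<close>

definition path_edge :: "(nat \<Rightarrow> nat) \<Rightarrow> nat \<Rightarrow> nat \<times> nat" where
  "path_edge p i = (min (path_vertex p i) (path_vertex p (Suc i)), max (path_vertex p i) (path_vertex p (Suc i)))"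

lemma enat_0_le [simp]: "enat 0 \<le> x"
  by (simp add: zero_enat_def[symmetric])

declare Suc_ile_eq [simp]

lemma path_vertex_simps [simp]:
  "path_vertex p 0 = 0" "path_vertex p (Suc i) = Suc (p i)"
  by (simp_all add: path_vertex_def)

lemma vertex_simps [simp]:
  "vertex v \<omega> 0 = v" "vertex v \<omega> (Suc n) = X n \<omega>"
  by (simp_all add: vertex_def)

text \<open>All vertices after the start are successors and so differ from 0. Self-avoidance of the
  whole path, with its \<open>k + 1\<close> vertices, thus amounts to injectivity of
  \<open>p\<close>.\<close>

lemma inj_on_path_vertex:
  "inj_on (path_vertex p) {..k} \<longleftrightarrow> inj_on p {..<k}"
proof -
  have "{..k} = insert 0 (Suc ` {..<k})"
    by (metis lessThan_Suc_atMost lessThan_Suc_eq_insert_0)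
  then show ?thesis
    by (auto simp: inj_on_def)
qed

lemma path_edge_in_mark_pairs:
  assumes "inj_on p {..<k}" "i < k"
  shows "path_edge p i \<in> mark_pairs"
proof -
  have "path_vertex p i \<noteq> path_vertex p (Suc i)"
    using assms inj_on_path_vertex[of p k] by (auto dest!: inj_onD[where x = i and y = "Suc i"] simp del: path_vertex_simps)
  then show ?thesis
    by (auto simp: path_edge_def mark_pairs_def simp del: path_vertex_simps)
qed

text \<open>Using one edge in both directions would force \<open>i = Suc j\<close> and
  \<open>Suc i = j\<close> at once. This is what makes the marks along a self-avoiding path
  independent.\<close>

lemma inj_on_path_edge:
  assumes "inj_on p {..<k}"
  shows "inj_on (path_edge p) {..<k}"
proof (rule inj_onI)
  fix i j assume ij: "i \<in> {..<k}" "j \<in> {..<k}" and eq: "path_edge p i = path_edge p j"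
  let ?q = "path_vertex p"
  have q: "?q a = ?q b \<longleftrightarrow> a = b" if "a \<le> k" "b \<le> k" for a b
    using assms that inj_on_path_vertex[of p k] by (auto simp: inj_on_eq_iff simp del: path_vertex_simps)
  have "{?q i, ?q (Suc i)} = {?q j, ?q (Suc j)}"
    using eq unfolding path_edge_def by (auto simp: min_def max_def simp del: path_vertex_simps split: if_splits)
  then have "?q i = ?q j \<or> ?q i = ?q (Suc j) \<and> ?q (Suc i) = ?q j"
    by (auto simp: doubleton_eq_iff simp del: path_vertex_simps)
  then show "i = j"
    using ij q[of i j] q[of i "Suc j"] q[of "Suc i" j] by (auto simp del: path_vertex_simps)
qed

lemma vertex_path_vertex: "vertex v \<omega> (path_vertex p i) = case_nat v (\<lambda>j. X (p j) \<omega>) i"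
  by (cases i) auto

lemma open_path_iff:
  "open_path k v p \<omega> \<longleftrightarrow> distinct_points {..<k} p \<omega> \<and>
     (\<forall>i<k. Z (path_edge p i) \<omega> \<le> \<phi> (case_nat v (\<lambda>j. X (p j) \<omega>) i) (X (p i) \<omega>))"
proof (cases "distinct_points {..<k} p \<omega>")
  case True
  then have inj: "inj_on (path_vertex p) {..k}" and N: "\<And>i. i < k \<Longrightarrow> enat (p i) < N \<omega>"
    by (auto simp: distinct_points_def inj_on_path_vertex)
  have "(path_vertex p i, path_vertex p (Suc i)) \<in> index_edges v \<omega> \<longleftrightarrow>
      Z (path_edge p i) \<omega> \<le> \<phi> (case_nat v (\<lambda>j. X (p j) \<omega>) i) (X (p i) \<omega>)" if "i < k" for i
  proof -
    have "path_vertex p i \<noteq> path_vertex p (Suc i)"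
      using inj_onD[OF inj, of i "Suc i"] that by auto
    moreover have "enat (path_vertex p j) < eSuc (N \<omega>)" if "j \<le> k" for j
      using that N by (cases j) auto
    ultimately show ?thesis
      using that unfolding index_edges_def
      by (simp add: path_edge_def vertex_path_vertex del: path_vertex_simps(2))
  qed
  with True show ?thesis
    by (simp add: open_path_def)
qed (simp add: open_path_def)

text \<open>Given the points, the marks on the edges of a self-avoiding path are independent, so the
  conditional probability that all its edges are open is the product of the connection
  probabilities.\<close>

lemma nn_integral_open_path:
  assumes p: "p \<in> PiE {..<k} (\<lambda>_. UNIV)"
  shows "(\<integral>\<^sup>+ \<omega>. of_bool (open_path k v p \<omega>) \<partial>M) =
    (\<integral>\<^sup>+ \<omega>. of_bool (distinct_points {..<k} p \<omega>) * path_weight k v (point_tuple {..<k} p \<omega>) \<partial>M)"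
proof (cases "inj_on p {..<k}")
  case False
  then show ?thesis by (simp add: open_path_def distinct_points_def)
next
  case inj: True
  let ?c = "\<lambda>x i. \<phi> (case_nat v (\<lambda>j. x (p j)) i) (x (p i))"
  \<comment> \<open>Openness as a function of number, points and marks separately, so that the
    points can be frozen.\<close>
  define f :: "enat \<Rightarrow> (nat \<Rightarrow> 'a) \<Rightarrow> (nat \<times> nat \<Rightarrow> real) \<Rightarrow> ennreal" where
    "f n x z = of_bool ((\<forall>i<k. enat (p i) < n) \<and> (\<forall>i<k. z (path_edge p i) \<le> ?c x i))" for n x z
  let ?S = "(count_space UNIV \<Otimes>\<^sub>M PiM UNIV (\<lambda>_. borel)) \<Otimes>\<^sub>M PiM mark_pairs (\<lambda>_. borel)
    :: ((enat \<times> (nat \<Rightarrow> 'a)) \<times> (nat \<times> nat \<Rightarrow> real)) measure"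
  have [measurable]: "(\<lambda>s. snd (fst s) i) \<in> ?S \<rightarrow>\<^sub>M borel" for i
    by measurable
  have [measurable]: "(\<lambda>s. ?c (snd (fst s)) i) \<in> borel_measurable ?S" for i
    by (cases i) auto
  have [measurable]: "(\<lambda>s. snd s (path_edge p i)) \<in> borel_measurable ?S" if "i < k" for i
    by (rule measurable_compose[OF measurable_snd measurable_component_singleton])
      (rule path_edge_in_mark_pairs[OF inj that])
  have [measurable]: "Measurable.pred ?S (\<lambda>s. i < k \<longrightarrow> snd s (path_edge p i) \<le> ?c (snd (fst s)) i)" for i
    by (cases "i < k") auto
  have "(\<lambda>s. f (fst (fst s)) (snd (fst s)) (snd s)) \<in> borel_measurable ?S"
    unfolding f_def by measurable
  then have f: "(\<lambda>((n, x), z). f n x z) \<in> borel_measurable ?S"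
    by (simp add: split_beta')
  \<comment> \<open>The edges of the path lie in \<open>mark_pairs\<close>, so restricting the marks
    loses nothing.\<close>
  have open_f: "of_bool (open_path k v p \<omega>) = f (N \<omega>) (\<lambda>n. X n \<omega>) (\<lambda>e\<in>mark_pairs. Z e \<omega>)" for \<omega>
    using inj path_edge_in_mark_pairs[OF inj] by (auto simp: f_def open_path_iff distinct_points_def)
  have "(\<integral>\<^sup>+ \<omega>'. f (N \<omega>) (\<lambda>n. X n \<omega>) (\<lambda>e\<in>mark_pairs. Z e \<omega>') \<partial>M) =
      of_bool (distinct_points {..<k} p \<omega>) * path_weight k v (point_tuple {..<k} p \<omega>)" for \<omega>
  proof -
    have "(\<integral>\<^sup>+ \<omega>'. f (N \<omega>) (\<lambda>n. X n \<omega>) (\<lambda>e\<in>mark_pairs. Z e \<omega>') \<partial>M) =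
        (\<integral>\<^sup>+ \<omega>'. of_bool (distinct_points {..<k} p \<omega>) *
          of_bool (\<forall>i\<in>{..<k}. Z (path_edge p i) \<omega>' \<le> ?c (\<lambda>n. X n \<omega>) i) \<partial>M)"
      using inj path_edge_in_mark_pairs[OF inj]
      by (intro nn_integral_cong) (auto simp: f_def distinct_points_def)
    also have "\<dots> = of_bool (distinct_points {..<k} p \<omega>) *
        (\<integral>\<^sup>+ \<omega>'. of_bool (\<forall>i\<in>{..<k}. Z (path_edge p i) \<omega>' \<le> ?c (\<lambda>n. X n \<omega>) i) \<partial>M)"
      by (cases "distinct_points {..<k} p \<omega>") auto
    also have "(\<integral>\<^sup>+ \<omega>'. of_bool (\<forall>i\<in>{..<k}. Z (path_edge p i) \<omega>' \<le> ?c (\<lambda>n. X n \<omega>) i) \<partial>M) =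
        (\<Prod>i<k. ennreal (?c (\<lambda>n. X n \<omega>) i))"
      using inj_on_path_edge[OF inj] path_edge_in_mark_pairs[OF inj] phi_range
      by (intro nn_integral_marks_le) auto
    also have "\<dots> = path_weight k v (point_tuple {..<k} p \<omega>)"
      unfolding path_weight_def by (intro prod.cong) (auto simp: point_tuple_def split: nat.split)
    finally show ?thesis .
  qed
  then show ?thesis
    unfolding open_f using nn_integral_points_marks[OF f] by simp
qed

text \<open>After the marks are averaged, the sum over index tuples is an integral of
  \<open>path_weight\<close> against the factorial moment measure, which is a product
  measure.\<close>

lemma expected_open_paths:
  "(\<integral>\<^sup>+ p. (\<integral>\<^sup>+ \<omega>. of_bool (open_path k v p \<omega>) \<partial>M) \<partial>tuples {..<k}) = (kernel ^^ k) (\<lambda>_. 1) v"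
proof -
  have "(\<integral>\<^sup>+ p. (\<integral>\<^sup>+ \<omega>. of_bool (open_path k v p \<omega>) \<partial>M) \<partial>tuples {..<k}) =
      (\<integral>\<^sup>+ p. (\<integral>\<^sup>+ \<omega>. of_bool (distinct_points {..<k} p \<omega>) *
        path_weight k v (point_tuple {..<k} p \<omega>) \<partial>M) \<partial>tuples {..<k})"
    by (rule nn_integral_cong) (simp add: nn_integral_open_path)
  also have "\<dots> = (\<integral>\<^sup>+ x. path_weight k v x \<partial>factorial_moment {..<k})"
    by (subst nn_integral_factorial_moment) auto
  finally have "(\<integral>\<^sup>+ p. (\<integral>\<^sup>+ \<omega>. of_bool (open_path k v p \<omega>) \<partial>M) \<partial>tuples {..<k}) =
      (\<integral>\<^sup>+ x. path_weight k v x \<partial>factorial_moment {..<k})" .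
  then show ?thesis
    by (simp add: factorial_moment_eq_PiM nn_integral_path_weight)
qed

text \<open>Loop erasure along a walk: if the next vertex was already visited, the path is cut back
  to that visit; otherwise the vertex is appended.\<close>

lemma open_path_if_in_index_cluster:
  assumes "(0, n) \<in> (index_edges v \<omega>)\<^sup>*"
  shows "\<exists>k p. p \<in> PiE {..<k} (\<lambda>_. UNIV) \<and> open_path k v p \<omega> \<and> path_vertex p k = n"
  using assms
proof (induction rule: rtrancl_induct)
  case base
  show ?case
    by (intro exI[of _ 0]) (auto simp: open_path_def distinct_points_def)
next
  case (step b c)
  then obtain k p where p: "p \<in> PiE {..<k} (\<lambda>_. UNIV)" "open_path k v p \<omega>" "path_vertex p k = b"
    by blast
  show ?case
  proof (cases "c \<in> path_vertex p ` {..k}")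
    case True
    then obtain i where i: "i \<le> k" "c = path_vertex p i" by auto
    define p' where "p' = restrict p {..<i}"
    have q: "path_vertex p' j = path_vertex p j" if "j \<le> i" for j
      using that by (cases j) (auto simp: p'_def)
    have "inj_on p' {..<i}"
      using p(2) i unfolding open_path_def distinct_points_def p'_def inj_on_def by auto
    moreover have "enat (p' j) < N \<omega>" if "j < i" for j
      using p(2) i that by (simp add: open_path_def distinct_points_def p'_def)
    moreover have "(path_vertex p' j, path_vertex p' (Suc j)) \<in> index_edges v \<omega>" if "j < i" for j
      using p(2) i that q[of j] q[of "Suc j"] by (simp add: open_path_def del: path_vertex_simps)
    ultimately have "open_path i v p' \<omega>"
      by (simp add: open_path_def distinct_points_def del: path_vertex_simps)
    moreover have "p' \<in> PiE {..<i} (\<lambda>_. UNIV)"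
      by (simp add: p'_def)
    moreover have "path_vertex p' i = c"
      using i q[of i] by simp
    ultimately show ?thesis by blast
  next
    case False
    \<comment> \<open>Vertex 0 is the start of the path, so a new vertex is a point of the process
      and has the form \<open>Suc c'\<close>.\<close>
    then have "c \<noteq> 0" by force
    then obtain c' where c': "c = Suc c'" by (cases c) auto
    define p' where "p' = p(k := c')"
    have q: "path_vertex p' j = path_vertex p j" if "j \<le> k" for j
      using that by (cases j) (auto simp: p'_def)
    have c'_notin: "c' \<notin> p ` {..<k}"
    proof
      assume "c' \<in> p ` {..<k}"
      then obtain j where "j < k" "c = path_vertex p (Suc j)"
        using c' by auto
      with False show False by (metis Suc_leI atMost_iff imageI)
    qed
    have "enat c' < N \<omega>"
      using step.hyps(2) c' by (auto simp: index_edges_def)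
    then have "distinct_points {..<Suc k} p' \<omega>"
      using p(2) c'_notin
      by (auto simp: open_path_def distinct_points_def p'_def lessThan_Suc inj_on_fun_updI)
    moreover have "(path_vertex p' i, path_vertex p' (Suc i)) \<in> index_edges v \<omega>" if "i < Suc k" for i
    proof (cases "i = k")
      case True
      then show ?thesis
        using step.hyps(2) p(3) c' q[of k] by (simp add: p'_def)
    next
      case False
      then have "i < k" using that by simp
      then show ?thesis
        using p(2) q[of i] q[of "Suc i"] by (simp add: open_path_def del: path_vertex_simps)
    qed
    ultimately have "open_path (Suc k) v p' \<omega>"
      by (simp add: open_path_def)
    moreover have "p' \<in> PiE {..<Suc k} (\<lambda>_. UNIV)"
      using p(1) by (simp add: p'_def PiE_iff extensional_def)
    moreover have "path_vertex p' (Suc k) = c"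
      using c' by (simp add: p'_def)
    ultimately show ?thesis by blast
  qed
qed

lemma path_vertex_in_index_cluster:
  assumes "open_path k v p \<omega>" "i \<le> k"
  shows "path_vertex p i \<in> index_cluster v \<omega>"
  using assms(2)
proof (induction i)
  case (Suc i)
  then have "(path_vertex p i, path_vertex p (Suc i)) \<in> index_edges v \<omega>"
    using assms(1) unfolding open_path_def by auto
  with Suc show ?case
    unfolding index_cluster_def by (auto intro: rtrancl_into_rtrancl simp del: path_vertex_simps)
qed (simp add: index_cluster_def)

text \<open>Written as an integral over index tuples so that Fubini gives its mean;
  \<open>open_paths_eq\<close> recovers the cardinality.\<close>

definition open_paths :: "nat \<Rightarrow> 'a \<Rightarrow> 'w \<Rightarrow> ennreal" where
  "open_paths k v \<omega> = (\<integral>\<^sup>+ p. of_bool (open_path k v p \<omega>) \<partial>tuples {..<k})"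

lemma open_paths_eq:
  "open_paths k v \<omega> = emeasure (count_space UNIV) {p \<in> PiE {..<k} (\<lambda>_. UNIV). open_path k v p \<omega>}"
proof -
  have "open_paths k v \<omega> = (\<integral>\<^sup>+ p. of_bool (open_path k v p \<omega>) * indicator (PiE {..<k} (\<lambda>_. UNIV)) p \<partial>count_space UNIV)"
    unfolding open_paths_def by (subst nn_integral_count_space_indicator) auto
  also have "\<dots> = (\<integral>\<^sup>+ p. indicator {p \<in> PiE {..<k} (\<lambda>_. UNIV). open_path k v p \<omega>} p \<partial>count_space UNIV)"
    by (intro nn_integral_cong) (auto simp: indicator_def)
  finally show ?thesis by simp
qed

lemma pred_open_path [measurable]:
  assumes "p \<in> PiE {..<k} (\<lambda>_. UNIV)"
  shows "Measurable.pred M (\<lambda>\<omega>. open_path k v p \<omega>)"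
\<comment> \<open>Injectivity places the path edges in \<open>mark_pairs\<close>, where marks are
  measurable. Otherwise the event is empty.\<close>
proof (cases "inj_on p {..<k}")
  case True
  define Q where "Q \<omega> i \<longleftrightarrow> (i < k \<longrightarrow> Z (path_edge p i) \<omega> \<le> \<phi> (case_nat v (\<lambda>j. X (p j) \<omega>) i) (X (p i) \<omega>))" for \<omega> i
  have [measurable]: "Measurable.pred M (\<lambda>\<omega>. Q \<omega> i)" for i
  proof (cases "i < k")
    case i: True
    note [measurable] = mark_measurable[OF path_edge_in_mark_pairs[OF True i]]
    have [measurable]: "(\<lambda>\<omega>. case_nat v (\<lambda>j. X (p j) \<omega>) i) \<in> M \<rightarrow>\<^sub>M borel"
      by (cases i) simp_all
    show ?thesis using i by (simp add: Q_def)
  qed (simp add: Q_def)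
  have "open_path k v p \<omega> \<longleftrightarrow> distinct_points {..<k} p \<omega> \<and> (\<forall>i. Q \<omega> i)" for \<omega>
    by (simp add: open_path_iff Q_def)
  then show ?thesis
    by simp
qed (simp add: open_path_def distinct_points_def)

lemma nn_integral_open_paths:
  "(\<integral>\<^sup>+ \<omega>. open_paths k v \<omega> \<partial>M) = (kernel ^^ k) (\<lambda>_. 1) v"
proof -
  interpret P: pair_sigma_finite "tuples {..<k}" M
    by (intro pair_sigma_finite.intro sigma_finite_measure_count_space_countable
        countable_tuples sigma_finite_measure_axioms) simp
  have "(\<lambda>(p, \<omega>). of_bool (open_path k v p \<omega>) :: ennreal) \<in> borel_measurable (tuples {..<k} \<Otimes>\<^sub>M M)"
    by (intro measurable_pair_measure_countable1 countable_tuples) auto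
  from P.Fubini'[OF this] show ?thesis
    by (simp add: open_paths_def expected_open_paths)
qed

text \<open>Each vertex of the cluster is the endpoint of at least one open path, so a union bound
  over the lengths applies.\<close>

lemma index_cluster_le_open_paths:
  "emeasure (count_space UNIV) (index_cluster v \<omega>) \<le> (\<Sum>k. open_paths k v \<omega>)"
proof -
  let ?P = "\<lambda>k. {p \<in> PiE {..<k} (\<lambda>_. UNIV). open_path k v p \<omega>}"
  have "index_cluster v \<omega> \<subseteq> (\<Union>k. (\<lambda>p. path_vertex p k) ` ?P k)"
  proof
    fix n assume "n \<in> index_cluster v \<omega>"
    then obtain k p where "p \<in> ?P k" "path_vertex p k = n"
      using open_path_if_in_index_cluster[of n v \<omega>] unfolding index_cluster_def by blast
    then show "n \<in> (\<Union>k. (\<lambda>p. path_vertex p k) ` ?P k)"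
      by blast
  qed
  then have "emeasure (count_space UNIV) (index_cluster v \<omega>) \<le>
      emeasure (count_space UNIV) (\<Union>k. (\<lambda>p. path_vertex p k) ` ?P k)"
    by (intro emeasure_mono) auto
  also have "\<dots> \<le> (\<Sum>k. emeasure (count_space UNIV) ((\<lambda>p. path_vertex p k) ` ?P k))"
    by (intro emeasure_subadditive_countably) auto
  also have "\<dots> \<le> (\<Sum>k. open_paths k v \<omega>)"
    unfolding open_paths_eq by (intro suminf_le emeasure_count_space_image_le) auto
  finally show ?thesis .
qed

text \<open>A path of length 1 is determined by its endpoint, which is a neighbour of the
  start.\<close>

lemma open_paths_1_le_index_cluster:
  "open_paths 1 v \<omega> \<le> emeasure (count_space UNIV) (index_cluster v \<omega>)"
proof -
  let ?P = "{p \<in> PiE {..<1} (\<lambda>_. UNIV). open_path 1 v p \<omega>}"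
  have "inj_on (\<lambda>p. path_vertex p 1) ?P"
    by (intro inj_onI PiE_ext[of _ "{..<1}" "\<lambda>_. UNIV"]) auto
  then have "open_paths 1 v \<omega> = emeasure (count_space UNIV) ((\<lambda>p. path_vertex p 1) ` ?P)"
    unfolding open_paths_eq by (rule emeasure_count_space_image[symmetric])
  also have "\<dots> \<le> emeasure (count_space UNIV) (index_cluster v \<omega>)"
    using path_vertex_in_index_cluster[of 1 v _ \<omega> 1] by (intro emeasure_mono) auto
  finally show ?thesis .
qed

section \<open>Joint measurability of the cluster size\<close>

lemma pred_index_edges [measurable]:
  "Measurable.pred (borel \<Otimes>\<^sub>M M) (\<lambda>x. (m, n) \<in> index_edges (fst x) (snd x))"
proof (cases "m = n")
  case False
  then have [measurable]: "Z (min m n, max m n) \<in> M \<rightarrow>\<^sub>M borel"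
    by (intro mark_measurable) (auto simp: mark_pairs_def)
  have [measurable]: "(\<lambda>x. vertex (fst x) (snd x) i) \<in> borel \<Otimes>\<^sub>M M \<rightarrow>\<^sub>M borel" for i
    by (cases i) auto
  have [measurable]: "Measurable.pred (borel \<Otimes>\<^sub>M M) (\<lambda>x. enat i < eSuc (N (snd x)))" for i
    by measurable
  show ?thesis
    unfolding index_edges_def by simp
qed (simp add: index_edges_def)

lemma pred_index_edges_relpow [measurable]:
  "Measurable.pred (borel \<Otimes>\<^sub>M M) (\<lambda>x. (m, n) \<in> index_edges (fst x) (snd x) ^^ k)"
proof (induction k arbitrary: n)
  case (Suc k)
  note [measurable] = Suc.IH
  have "(m, n) \<in> index_edges (fst x) (snd x) ^^ Suc k \<longleftrightarrow>
      (\<exists>l. (m, l) \<in> index_edges (fst x) (snd x) ^^ k \<and> (l, n) \<in> index_edges (fst x) (snd x))" for x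
    by auto
  then show ?case
    by simp
qed simp

text \<open>Reachability is a countable union over the number of steps. Measurability is joint in
  start point and outcome so that integrating out the outcome leaves a measurable function of
  \<open>v\<close>.\<close>

lemma index_cluster_measurable [measurable]:
  "(\<lambda>x. emeasure (count_space UNIV) (index_cluster (fst x) (snd x))) \<in> borel_measurable (borel \<Otimes>\<^sub>M M)"
proof -
  have "emeasure (count_space UNIV) (index_cluster v \<omega>) = (\<Sum>n. of_bool (\<exists>k. (0, n) \<in> index_edges v \<omega> ^^ k))" for v \<omega>
  proof -
    have "emeasure (count_space UNIV) (index_cluster v \<omega>) =
        (\<integral>\<^sup>+ n. indicator (index_cluster v \<omega>) n \<partial>count_space UNIV)"
      by simp
    also have "\<dots> = (\<Sum>n. indicator (index_cluster v \<omega>) n)"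
      by (rule nn_integral_count_space_nat)
    also have "\<dots> = (\<Sum>n. of_bool (\<exists>k. (0, n) \<in> index_edges v \<omega> ^^ k))"
      by (intro arg_cong[where f = suminf] ext) (auto simp: index_cluster_def rtrancl_power indicator_def)
    finally show ?thesis .
  qed
  then show ?thesis
    by simp
qed

section \<open>From indices back to points, and bounds for the expected cluster size\<close>

lemma AE_inj_on_vertex:
  "AE \<omega> in M. inj_on (vertex v \<omega>) {n. enat n < eSuc (N \<omega>)}"
proof -
  \<comment> \<open>As \<open>{v}\<close> has measure 0, its void probability is
    \<open>exp 0\<close>: the added point almost surely differs from all points of the
    process.\<close>
  have "prob {\<omega> \<in> space M. point_count N X {v} \<omega> = of_nat 0} = 1"
    using count_finite[of "{v}" 0] by (simp add: diffuse measure_def)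
  then have "AE \<omega> in M. \<omega> \<in> {\<omega> \<in> space M. point_count N X {v} \<omega> = of_nat 0}"
    by (rule AE_prob_1)
  with simple show ?thesis
  proof eventually_elim
    case (elim \<omega>)
    then have "point_count N X {v} \<omega> = 0" by simp
    then have v: "X n \<omega> \<noteq> v" if "enat n < N \<omega>" for n
      using that unfolding point_count_def
      by (subst (asm) emeasure_count_space_eq_0) auto
    show ?case
    proof (rule inj_onI)
      fix m n assume "m \<in> {n. enat n < eSuc (N \<omega>)}" "n \<in> {n. enat n < eSuc (N \<omega>)}" "vertex v \<omega> m = vertex v \<omega> n"
      then show "m = n"
        using v v[symmetric] by (cases m; cases n) (auto simp: inj_on_eq_iff[OF elim(1)])
    qed
  qed
qed

text \<open>A walk on points lifts to a walk on indices, because two consecutive edges that share a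
  point share its index by injectivity.\<close>

lemma vertex_cluster_eq_image:
  assumes inj: "inj_on (vertex v \<omega>) {n. enat n < eSuc (N \<omega>)}"
  shows "vertex_cluster \<phi> N X Z v \<omega> = vertex v \<omega> ` index_cluster v \<omega>"
proof -
  let ?E = "rcm_edges \<phi> (eSuc (N \<omega>)) (vertex v \<omega>) (\<lambda>e. Z e \<omega>)"
  have E: "?E = {(vertex v \<omega> m, vertex v \<omega> n) | m n. (m, n) \<in> index_edges v \<omega>}"
    by (auto simp: rcm_edges_def index_edges_def)
  have range: "enat n < eSuc (N \<omega>)" if "n \<in> index_cluster v \<omega>" for n
    using that unfolding index_cluster_def by (auto elim!: rtranclE simp: index_edges_def)
  have "y \<in> vertex v \<omega> ` index_cluster v \<omega>" if "(v, y) \<in> ?E\<^sup>*" for y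
    using that
  proof (induction rule: rtrancl_induct)
    case base
    then show ?case
      by (intro image_eqI[of _ _ 0]) (auto simp: index_cluster_def)
  next
    case (step y z)
    then obtain b m n where "y = vertex v \<omega> b" "b \<in> index_cluster v \<omega>" "y = vertex v \<omega> m"
        "z = vertex v \<omega> n" "(m, n) \<in> index_edges v \<omega>"
      unfolding E by blast
    moreover from this have "b = m"
      using range[of b] by (intro inj_onD[OF inj]) (auto simp: index_edges_def)
    ultimately show ?case
      unfolding index_cluster_def by (auto intro: rtrancl_into_rtrancl)
  qed
  moreover have "(v, vertex v \<omega> n) \<in> ?E\<^sup>*" if "(0, n) \<in> (index_edges v \<omega>)\<^sup>*" for n
    using that
  proof (induction rule: rtrancl_induct)
    case (step b c)
    then have "(vertex v \<omega> b, vertex v \<omega> c) \<in> ?E"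
      unfolding E by blast
    with step.IH show ?case
      by (rule rtrancl_into_rtrancl)
  qed simp
  ultimately show ?thesis
    unfolding vertex_cluster_def component_def vertex_def[symmetric] by (auto simp: index_cluster_def)
qed

text \<open>Counting indices instead of points alters the integrand only on a null set, which may
  depend on \<open>v\<close>, and yields an integrand that is jointly measurable.\<close>

lemma expected_cluster_size_eq:
  "expected_cluster_size M \<phi> N X Z v = (\<integral>\<^sup>+ \<omega>. emeasure (count_space UNIV) (index_cluster v \<omega>) \<partial>M)"
  unfolding expected_cluster_size_def
proof (rule nn_integral_cong_AE)
  show "AE \<omega> in M. emeasure (count_space UNIV) (vertex_cluster \<phi> N X Z v \<omega>) =
      emeasure (count_space UNIV) (index_cluster v \<omega>)"
    using AE_inj_on_vertex[of v]
  proof eventually_elim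
    case (elim \<omega>)
    have "index_cluster v \<omega> \<subseteq> {n. enat n < eSuc (N \<omega>)}"
      unfolding index_cluster_def by (auto elim!: rtranclE simp: index_edges_def)
    then show ?case
      unfolding vertex_cluster_eq_image[OF elim]
      by (intro emeasure_count_space_image inj_on_subset[OF elim])
  qed
qed

lemma expected_cluster_size_measurable:
  "expected_cluster_size M \<phi> N X Z \<in> borel_measurable borel"
  unfolding expected_cluster_size_eq[abs_def]
  using borel_measurable_nn_integral[of "\<lambda>v \<omega>. emeasure (count_space UNIV) (index_cluster v \<omega>)" borel]
    index_cluster_measurable by (simp add: split_beta')

lemma expected_cluster_size_le:
  "expected_cluster_size M \<phi> N X Z v \<le> (\<Sum>k. (kernel ^^ k) (\<lambda>_. 1) v)"
proof -
  have m: "open_paths k v \<in> borel_measurable M" for k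
  proof -
    have "(\<lambda>(p, \<omega>). of_bool (open_path k v p \<omega>) :: ennreal) \<in> borel_measurable (tuples {..<k} \<Otimes>\<^sub>M M)"
      by (intro measurable_pair_measure_countable1 countable_tuples) auto
    from measurable_pair_swap[OF this]
    have "(\<lambda>(\<omega>, p). of_bool (open_path k v p \<omega>) :: ennreal) \<in> borel_measurable (M \<Otimes>\<^sub>M tuples {..<k})"
      by simp
    moreover have "sigma_finite_measure (tuples {..<k})"
      by (intro sigma_finite_measure_count_space_countable countable_tuples) simp
    ultimately show ?thesis
      unfolding open_paths_def[abs_def] by (intro sigma_finite_measure.borel_measurable_nn_integral)
  qed
  have "expected_cluster_size M \<phi> N X Z v \<le> (\<integral>\<^sup>+ \<omega>. (\<Sum>k. open_paths k v \<omega>) \<partial>M)"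
    unfolding expected_cluster_size_eq by (intro nn_integral_mono index_cluster_le_open_paths)
  also have "\<dots> = (\<Sum>k. (kernel ^^ k) (\<lambda>_. 1) v)"
    using m by (simp add: nn_integral_suminf nn_integral_open_paths)
  finally show ?thesis .
qed

text \<open>The left-hand side is the mean degree of \<open>v\<close>.\<close>

lemma expected_cluster_size_ge:
  "kernel (\<lambda>_. 1) v \<le> expected_cluster_size M \<phi> N X Z v"
proof -
  have "kernel (\<lambda>_. 1) v = (\<integral>\<^sup>+ \<omega>. open_paths 1 v \<omega> \<partial>M)"
    by (simp add: nn_integral_open_paths)
  also have "\<dots> \<le> expected_cluster_size M \<phi> N X Z v"
    unfolding expected_cluster_size_eq by (intro nn_integral_mono open_paths_1_le_index_cluster)
  finally show ?thesis .
qed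

end

section \<open>Bounds for the critical intensity\<close>

lemma sigma_finite_measure_if_locally_finite:
  fixes \<mu> :: "'a::metric_space measure"
  assumes sets: "sets \<mu> = sets borel"
    and finite: "\<And>B. B \<in> sets borel \<Longrightarrow> bounded B \<Longrightarrow> emeasure \<mu> B < \<infinity>"
  shows "sigma_finite_measure \<mu>"
proof
  obtain a :: 'a where True by blast
  have "\<exists>n. dist a x < real n" for x
    using reals_Archimedean2 by blast
  then have "(\<Union>n. ball a (real n)) = UNIV"
    by auto
  then show "\<exists>A. countable A \<and> A \<subseteq> sets \<mu> \<and> \<Union> A = space \<mu> \<and> (\<forall>a\<in>A. emeasure \<mu> a \<noteq> \<infinity>)"
    using finite[of "ball a _"] sets sets_eq_imp_space_eq[OF sets]
    by (intro exI[of _ "range (\<lambda>n. ball a (real n))"]) (auto simp: top.not_eq_extremum)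
qed

theorem lemma6p1:
  fixes \<Lambda> :: "'a::polish_space measure"
    and \<phi> :: "'a \<Rightarrow> 'a \<Rightarrow> real"
    and M :: "real \<Rightarrow> 'w measure"
    and N :: "real \<Rightarrow> 'w \<Rightarrow> enat"
    and X :: "real \<Rightarrow> nat \<Rightarrow> 'w \<Rightarrow> 'a"
    and Z :: "real \<Rightarrow> nat \<times> nat \<Rightarrow> 'w \<Rightarrow> real"
  assumes sets_Lambda: "sets \<Lambda> = sets borel"
    and locally_finite: "\<And>B. B \<in> sets borel \<Longrightarrow> bounded B \<Longrightarrow> emeasure \<Lambda> B < \<infinity>"
    and diffuse: "\<And>x. emeasure \<Lambda> {x} = 0"
    and phi_measurable: "(\<lambda>(x, y). \<phi> x y) \<in> borel_measurable (borel \<Otimes>\<^sub>M borel)"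
    and phi_range: "\<And>x y. 0 \<le> \<phi> x y \<and> \<phi> x y \<le> 1"
    and phi_symmetric: "\<And>x y. \<phi> x y = \<phi> y x"
    and D_finite: "AE x in \<Lambda>. D_phi \<Lambda> \<phi> x < \<infinity>"
    and rcm: "\<And>t. 0 \<le> t \<Longrightarrow> poisson_rcm (M t) (scale_measure (ennreal t) \<Lambda>) (N t) (X t) (Z t)"
  defines "tT \<equiv> t_T \<Lambda> (\<lambda>t. expected_cluster_size (M t) \<phi> (N t) (X t) (Z t))"
  shows "tT \<ge> inverse (D_star \<Lambda> \<phi>) \<and> (tT > 0 \<longleftrightarrow> D_star \<Lambda> \<phi> < \<infinity>)"
proof -
  let ?S = "\<lambda>t. expected_cluster_size (M t) \<phi> (N t) (X t) (Z t)"
  let ?D = "D_star \<Lambda> \<phi>"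
  have sets_scale: "sets (scale_measure r \<Lambda>) = sets borel" for r
    by (simp add: sets_Lambda)
  have phi_section: "(\<lambda>y. ennreal (\<phi> v y)) \<in> borel_measurable \<Lambda>" for v
    using measurable_compose[OF measurable_Pair1' phi_measurable, of v]
    by (simp add: measurable_cong_sets[OF sets_Lambda refl])
  interpret L: sigma_finite_measure \<Lambda>
    using sets_Lambda locally_finite by (rule sigma_finite_measure_if_locally_finite)
  have D_measurable: "D_phi \<Lambda> \<phi> \<in> borel_measurable \<Lambda>"
  proof -
    have "(\<lambda>(x, y). ennreal (\<phi> x y)) \<in> borel_measurable (\<Lambda> \<Otimes>\<^sub>M \<Lambda>)"
      using measurable_compose[OF phi_measurable measurable_ennreal]
      by (simp add: split_beta' measurable_cong_sets[OF sets_pair_measure_cong[OF sets_Lambda sets_Lambda] refl])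
    then show ?thesis
      unfolding D_phi_def[abs_def] by (rule L.borel_measurable_nn_integral)
  qed
  have D_le: "AE v in \<Lambda>. D_phi \<Lambda> \<phi> v \<le> ?D"
    unfolding D_star_def by (rule esssup_AE)
  have rcm': "diffuse_poisson_rcm (M t) (scale_measure (ennreal t) \<Lambda>) (N t) (X t) (Z t) \<phi>" if t: "0 \<le> t" for t
  proof -
    interpret R: poisson_rcm "M t" "scale_measure (ennreal t) \<Lambda>" "N t" "X t" "Z t"
      using t by (rule rcm)
    have "sigma_finite_measure (scale_measure (ennreal t) \<Lambda>)"
      using locally_finite
      by (intro sigma_finite_measure_if_locally_finite sets_scale) (simp add: ennreal_mult_less_top)
    then show ?thesis
      using diffuse phi_measurable phi_range sets_scale
      by (intro diffuse_poisson_rcm.intro diffuse_poisson_process.intro diffuse_poisson_rcm_axioms.intro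
          diffuse_poisson_process_axioms.intro) (auto intro: R.poisson_rcm_axioms R.poisson_process_axioms)
  qed
  have kernel_eq: "diffuse_poisson_rcm.kernel (scale_measure (ennreal t) \<Lambda>) \<phi> (\<lambda>_. 1) v = ennreal t * D_phi \<Lambda> \<phi> v"
    if "0 \<le> t" for t v
    using diffuse_poisson_rcm.kernel_def[OF rcm'[OF that], of "\<lambda>_. 1" v] phi_section
    by (simp add: D_phi_def nn_integral_scale_measure)
  have S_measurable: "?S t \<in> borel_measurable \<Lambda>" if "0 \<le> t" for t
    using diffuse_poisson_rcm.expected_cluster_size_measurable[OF rcm'[OF that]]
    by (simp add: measurable_cong_sets[OF sets_Lambda refl])
  have subcritical: "ennreal t \<le> tT" if t: "0 \<le> t" "ennreal t * ?D < 1" for t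
  proof -
    interpret R: diffuse_poisson_rcm "M t" "scale_measure (ennreal t) \<Lambda>" "N t" "X t" "Z t" \<phi>
      using t(1) by (rule rcm')
    define d where "d = ennreal t * ?D"
    obtain r where r: "d = ennreal r" "0 \<le> r" "r < 1"
      using t(2) unfolding d_def[symmetric] by (cases d) auto
    have bound: "AE v in \<Lambda>. ?S t v \<le> ennreal (1 / (1 - r))"
    \<comment> \<open>At \<open>t = 0\<close> every property holds almost everywhere for the scaled
      measure, so nothing transfers to \<open>\<Lambda>\<close>. But then the kernel vanishes and
      only the path of length 0 contributes, even if \<open>?D\<close> is infinite.\<close>
    proof (cases "t = 0")
      case True
      have "R.kernel g v = 0" for g v
        unfolding R.kernel_def using True by simp
      then have "(R.kernel ^^ k) (\<lambda>_. 1) v = 0" if "k \<noteq> 0" for k v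
        using that by (cases k) auto
      then have "(\<Sum>k. (R.kernel ^^ k) (\<lambda>_. 1) v) = (\<Sum>k\<in>{0}. (R.kernel ^^ k) (\<lambda>_. 1) v)" for v
        by (intro suminf_finite) auto
      then have "?S t v \<le> 1" for v
        using R.expected_cluster_size_le[of v] by simp
      moreover have "1 \<le> ennreal (1 / (1 - r))"
        using r by (simp add: field_simps)
      ultimately show ?thesis
        using order_trans by blast
    next
      case False
      have AE: "(AE v in scale_measure (ennreal t) \<Lambda>. P v) \<longleftrightarrow> (AE v in \<Lambda>. P v)" for P
        using False t(1) by (simp add: eventually_ae_filter null_sets_def space_scale_measure)
      have "AE v in scale_measure (ennreal t) \<Lambda>. R.kernel (\<lambda>_. 1) v \<le> d"
        unfolding AE using D_le by eventually_elim (simp add: kernel_eq[OF t(1)] d_def mult_left_mono)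
      \<comment> \<open>One null set for all lengths \<open>k\<close>, as there are countably
        many.\<close>
      then have "AE v in \<Lambda>. \<forall>k. (R.kernel ^^ k) (\<lambda>_. 1) v \<le> d ^ k"
        using R.AE_funpow_kernel_le unfolding AE AE_all_countable by blast
      then show ?thesis
      proof eventually_elim
        case (elim v)
        have "?S t v \<le> (\<Sum>k. (R.kernel ^^ k) (\<lambda>_. 1) v)"
          by (rule R.expected_cluster_size_le)
        also have "\<dots> \<le> (\<Sum>k. ennreal (r ^ k))"
          using elim r by (intro suminf_le) (auto simp: ennreal_power)
        also have "\<dots> = ennreal (1 / (1 - r))"
          using r geometric_sums[of r] by (intro suminf_ennreal_eq) auto
        finally show ?case .
      qed
    qed
    then have "esssup \<Lambda> (?S t) \<le> ennreal (1 / (1 - r))"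
      using S_measurable[OF t(1)] by (intro esssup_I)
    then have "esssup \<Lambda> (?S t) < \<infinity>"
      using le_less_trans by fastforce
    then show ?thesis
      unfolding tT_def t_T_def using t(1) by (intro Sup_upper) auto
  qed
  have ge: "inverse ?D \<le> tT"
  \<comment> \<open>The geometric series needs \<open>t * ?D\<close> strictly below 1, so the bound
    is shown for every \<open>y\<close> strictly below the inverse.\<close>
  proof (rule dense_le)
    fix y assume y: "y < inverse ?D"
    then obtain t where t: "y = ennreal t" "0 \<le> t"
      by (cases y) auto
    have "ennreal t * ?D < 1"
    \<comment> \<open>If a factor is 0, so is the product, even for \<open>t = 0\<close> and
      infinite \<open>?D\<close>. Otherwise \<open>?D\<close> is finite, since the inverse of
      \<infinity> is 0 and nothing lies below it.\<close>
    proof (cases "?D = 0 \<or> t = 0")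
      case False
      then have "?D \<noteq> \<infinity>"
        using y by auto
      then obtain s where s: "?D = ennreal s" "0 < s"
        using False by (cases ?D) auto
      have "t < inverse s"
        using y s t by (simp add: inverse_ennreal ennreal_less_iff)
      then have "t * s < 1"
        using s by (simp add: field_simps)
      then show ?thesis
        using s t by (simp add: ennreal_mult[symmetric] ennreal_less_iff)
    qed auto
    with t show "y \<le> tT"
      using subcritical by simp
  qed
  moreover have "0 < tT" if "?D < \<infinity>"
  proof -
    have "0 < inverse ?D"
      using that by (simp add: ennreal_inverse_positive)
    with ge show ?thesis by order
  qed
  moreover have "?D < \<infinity>" if "0 < tT"
  proof -
    \<comment> \<open>A positive supremum is exceeded from 0 by some member of the set, which gives
      a strictly positive \<open>t\<close> by which the degree bound can be divided.\<close>
    obtain t where t: "0 \<le> t" "0 < ennreal t" "esssup \<Lambda> (?S t) < \<infinity>"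
    proof -
      obtain y where "y \<in> {ennreal t | t. 0 \<le> t \<and> esssup \<Lambda> (?S t) < \<infinity>}" "0 < y"
        using \<open>0 < tT\<close> unfolding tT_def t_T_def less_Sup_iff by (elim bexE)
      then show ?thesis
        using that by (elim CollectE exE conjE) simp
    qed
    interpret R: diffuse_poisson_rcm "M t" "scale_measure (ennreal t) \<Lambda>" "N t" "X t" "Z t" \<phi>
      using t(1) by (rule rcm')
    have "AE v in \<Lambda>. D_phi \<Lambda> \<phi> v \<le> esssup \<Lambda> (?S t) / ennreal t"
      using esssup_AE[of "?S t" \<Lambda>]
    proof eventually_elim
      case (elim v)
      have "D_phi \<Lambda> \<phi> v * ennreal t \<le> esssup \<Lambda> (?S t)"
        using R.expected_cluster_size_ge[of v] elim by (simp add: kernel_eq[OF t(1)] mult.commute)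
      then have "D_phi \<Lambda> \<phi> v * ennreal t / ennreal t \<le> esssup \<Lambda> (?S t) / ennreal t"
        by (rule divide_right_mono_ennreal)
      then show ?case
        using t(2) by (simp add: ennreal_mult_divide_eq)
    qed
    then have "?D \<le> esssup \<Lambda> (?S t) / ennreal t"
      unfolding D_star_def using D_measurable by (intro esssup_I)
    also have "\<dots> < \<infinity>"
      using t by (simp add: ennreal_divide_eq_top_iff less_top[symmetric])
    finally show ?thesis .
  qed
  ultimately show ?thesis by blast
qed

end
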